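(* Let $G$ be a connected, well-edge-dominated graph containing exactly one triangle $xyz$ such that the subgraph induced by $V(G)-\{x,y,z\}$ contains a nontrivial component no vertex of which is adjacent to $x$ or to $y$. Then $G\in\mathcal{F}\cup\mathcal{T}$.
   Context: All graphs are simple and finite. A set $F$ of edges of $G$ is an edge dominating set if every edge of $G$ is in $F$ or shares an endpoint with an edge of $F$. $G$ is well-edge-dominated if all minimal (with respect to inclusion) edge dominating sets of $G$ have the same cardinality. A triangle is a subgraph isomorphic to $K_3$. A graph is nontrivial if it has at least two vertices. A support vertex is a vertex adjacent to a vertex of degree $1$. Let $G'$ be a well-edge-dominated bipartite graph with bipartition $V(G')=A\cup B$, $|A|<|B|$. A vertex $w\in B$ is detachable if $G'-w$ is well-edge-dominated; it is strongly detachable if it is detachable and every vertex of $N_{G'}(w)$ is a support vertex in $G'-w$. The house graph $\mathcal{H}$ has vertices $p_1,\dots,p_5$ and edges $p_1p_2,p_2p_3,p_3p_4,p_4p_1,p_3p_5,p_4p_5$. $\mathcal{T}$ is the family of graphs obtained from the disjoint union of $K_3$ and a well-edge-dominated bipartite graph $G'$ with bipartition $A\cup B$, $|A|<|B|$, by identifying a vertex of $K_3$ with a detachable vertex $w\in B$ of $G'$. $\mathcal{F}$ is the family of graphs obtained from the disjoint union of $\mathcal{H}$ and such a graph $G'$ by identifying the vertex $p_5$ of $\mathcal{H}$ with a strongly detachable vertex $w\in B$ of $G'$. *)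

theory Defs
  imports Main
begin

record 'a graph =
  verts :: "'a set"
  edges :: "'a set set"

definition simple_graph :: "'a graph \<Rightarrow> bool" where
  "simple_graph G \<longleftrightarrow> finite (verts G) \<and> (\<forall>e\<in>edges G. e \<subseteq> verts G \<and> card e = 2)"

definition adj :: "'a graph \<Rightarrow> 'a \<Rightarrow> 'a \<Rightarrow> bool" where
  "adj G u v \<longleftrightarrow> {u, v} \<in> edges G"

definition nbrs :: "'a graph \<Rightarrow> 'a \<Rightarrow> 'a set" where
  "nbrs G v = {u \<in> verts G. adj G v u}"

definition degree :: "'a graph \<Rightarrow> 'a \<Rightarrow> nat" where
  "degree G v = card (nbrs G v)"

definition support_vertex :: "'a graph \<Rightarrow> 'a \<Rightarrow> bool" where
  "support_vertex G v \<longleftrightarrow> v \<in> verts G \<and> (\<exists>u\<in>nbrs G v. degree G u = 1)"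

definition nontrivial :: "'a graph \<Rightarrow> bool" where
  "nontrivial G \<longleftrightarrow> card (verts G) \<ge> 2"

definition subgraph :: "'a graph \<Rightarrow> 'a graph \<Rightarrow> bool" where
  "subgraph H G \<longleftrightarrow> simple_graph H \<and> verts H \<subseteq> verts G \<and> edges H \<subseteq> edges G"

definition induced_subgraph :: "'a graph \<Rightarrow> 'a set \<Rightarrow> 'a graph" where
  "induced_subgraph G S = \<lparr>verts = verts G \<inter> S, edges = {e \<in> edges G. e \<subseteq> S}\<rparr>"

definition del_vertex :: "'a graph \<Rightarrow> 'a \<Rightarrow> 'a graph" where
  "del_vertex G v = induced_subgraph G (verts G - {v})"

definition connected :: "'a graph \<Rightarrow> bool" where
  "connected G \<longleftrightarrow> verts G \<noteq> {} \<and>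
     (\<forall>u\<in>verts G. \<forall>v\<in>verts G. (u, v) \<in> {(a, b). adj G a b}\<^sup>*)"

definition component :: "'a graph \<Rightarrow> 'a graph \<Rightarrow> bool" where
  "component C G \<longleftrightarrow> subgraph C G \<and> connected C \<and>
     (\<forall>D. subgraph D G \<and> connected D \<and> subgraph C D \<longrightarrow> D = C)"

definition isomorphic :: "'a graph \<Rightarrow> 'b graph \<Rightarrow> bool" where
  "isomorphic G H \<longleftrightarrow> (\<exists>f. bij_betw f (verts G) (verts H) \<and>
     (\<forall>u\<in>verts G. \<forall>v\<in>verts G. adj G u v \<longleftrightarrow> adj H (f u) (f v)))"

definition K3 :: "nat graph" where
  "K3 = \<lparr>verts = {1, 2, 3}, edges = {{1, 2}, {2, 3}, {1, 3}}\<rparr>"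

definition triangle :: "'a graph \<Rightarrow> 'a graph \<Rightarrow> bool" where
  "triangle T G \<longleftrightarrow> subgraph T G \<and> isomorphic T K3"

definition house :: "nat graph" where
  "house = \<lparr>verts = {1, 2, 3, 4, 5},
     edges = {{1, 2}, {2, 3}, {3, 4}, {4, 1}, {3, 5}, {4, 5}}\<rparr>"

definition edge_dominating :: "'a graph \<Rightarrow> 'a set set \<Rightarrow> bool" where
  "edge_dominating G F \<longleftrightarrow> F \<subseteq> edges G \<and>
     (\<forall>e\<in>edges G. e \<in> F \<or> (\<exists>f\<in>F. e \<inter> f \<noteq> {}))"

definition minimal_edge_dominating :: "'a graph \<Rightarrow> 'a set set \<Rightarrow> bool" where
  "minimal_edge_dominating G F \<longleftrightarrow>
     edge_dominating G F \<and> (\<forall>F'. F' \<subset> F \<longrightarrow> \<not> edge_dominating G F')"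

definition well_edge_dominated :: "'a graph \<Rightarrow> bool" where
  "well_edge_dominated G \<longleftrightarrow> (\<forall>F F'. minimal_edge_dominating G F \<longrightarrow>
     minimal_edge_dominating G F' \<longrightarrow> card F = card F')"

definition bipartition :: "'a graph \<Rightarrow> 'a set \<Rightarrow> 'a set \<Rightarrow> bool" where
  "bipartition G A B \<longleftrightarrow> verts G = A \<union> B \<and> A \<inter> B = {} \<and>
     (\<forall>e\<in>edges G. \<exists>a\<in>A. \<exists>b\<in>B. e = {a, b})"

definition wed_bipartite :: "'a graph \<Rightarrow> 'a set \<Rightarrow> 'a set \<Rightarrow> bool" where
  "wed_bipartite G A B \<longleftrightarrow>
     simple_graph G \<and> well_edge_dominated G \<and> bipartition G A B \<and> card A < card B"

definition detachable :: "'a graph \<Rightarrow> 'a set \<Rightarrow> 'a \<Rightarrow> bool" where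
  "detachable G B w \<longleftrightarrow> w \<in> B \<and> well_edge_dominated (del_vertex G w)"

definition strongly_detachable :: "'a graph \<Rightarrow> 'a set \<Rightarrow> 'a \<Rightarrow> bool" where
  "strongly_detachable G B w \<longleftrightarrow> detachable G B w \<and>
     (\<forall>v\<in>nbrs G w. support_vertex (del_vertex G w) v)"

definition disjoint_union :: "'a graph \<Rightarrow> 'b graph \<Rightarrow> ('a + 'b) graph" where
  "disjoint_union G H = \<lparr>verts = verts G <+> verts H,
     edges = (\<lambda>e. Inl ` e) ` edges G \<union> (\<lambda>e. Inr ` e) ` edges H\<rparr>"

definition identify :: "'a \<Rightarrow> 'a \<Rightarrow> 'a graph \<Rightarrow> 'a graph" where
  "identify u v G = \<lparr>verts = id(u := v) ` verts G,
     edges = (\<lambda>e. id(u := v) ` e) ` edges G\<rparr>"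

text \<open>
  The two families are closed under isomorphism. Letting \<open>G'\<close> range over graphs with
  vertices in the vertex type of \<open>G\<close> is no restriction: \<open>G'\<close> embeds into the glued
  graph, hence has a copy inside \<open>G\<close>.
\<close>

definition family_T :: "'a graph set" where
  "family_T = {G. simple_graph G \<and> (\<exists>(G' :: 'a graph) A B w p.
     wed_bipartite G' A B \<and> detachable G' B w \<and> p \<in> verts K3 \<and>
     isomorphic G (identify (Inl p) (Inr w) (disjoint_union K3 G')))}"

definition family_F :: "'a graph set" where
  "family_F = {G. simple_graph G \<and> (\<exists>(G' :: 'a graph) A B w.
     wed_bipartite G' A B \<and> strongly_detachable G' B w \<and>
     isomorphic G (identify (Inl 5) (Inr w) (disjoint_union house G')))}"

end

theory Submission
  imports Defs
begin

text \<open>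
  All maximal matchings of a well-edge-dominated graph have the same size, and deleting the
  endpoints of an edge preserves both properties. Call \<open>z\<close> loose in \<open>S\<close> if \<open>S\<close> and \<open>S - z\<close> both
  have this property, with the same size of matching. In a triangle-free \<open>S\<close> the part
  containing a loose vertex \<open>z\<close> is bipartite, by induction: for an edge \<open>zc\<close>, every other
  neighbour of \<open>c\<close> is loose in \<open>S - z - c\<close>. The class of \<open>z\<close> consists of the vertices missed by
  some maximum matching, so it is the larger one.

  Let \<open>U\<close> be \<open>V(G) - {x, y, z}\<close>. A maximal matching of \<open>U\<close> missing neighbours \<open>x'\<close>, \<open>y'\<close> of \<open>x\<close>
  and \<open>y\<close> could be enlarged too much by \<open>xx'\<close>, \<open>yy'\<close> and an edge from \<open>z\<close> into the given
  component; hence \<open>x\<close>, \<open>y\<close>, \<open>z\<close> are all loose when added to \<open>U\<close>. Playing \<open>x\<close> and \<open>y\<close> against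
  each other, their neighbourhoods in \<open>U\<close> are either both empty (the family \<open>\<T>\<close>) or
  span, with \<open>x\<close> and \<open>y\<close>, a complete bipartite graph, and edge dominating sets
  containing stars leave only the house (the family \<open>\<F>\<close>).
\<close>

section \<open>Matchings and looseness\<close>

locale edge_set =
  fixes E :: "'a set set"
  assumes finite_E: "finite E" and card_edge: "e \<in> E \<Longrightarrow> card e = 2"
begin

definition matching :: "'a set \<Rightarrow> 'a set set \<Rightarrow> bool" where
  "matching S M \<longleftrightarrow> M \<subseteq> E \<and> \<Union>M \<subseteq> S \<and> pairwise disjnt M"

text \<open>Maximal under inclusion: an edge inside \<open>S\<close> that misses
  \<open>\<Union>M\<close> could still be added.\<close>

definition max_matching :: "'a set \<Rightarrow> 'a set set \<Rightarrow> bool" where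
  "max_matching S M \<longleftrightarrow> matching S M \<and> (\<forall>e\<in>E. e \<subseteq> S \<longrightarrow> e \<inter> \<Union>M \<noteq> {})"

definition equimatchable :: "'a set \<Rightarrow> nat \<Rightarrow> bool" where
  "equimatchable S n \<longleftrightarrow> (\<forall>M. max_matching S M \<longrightarrow> card M = n)"

definition loose :: "'a set \<Rightarrow> 'a \<Rightarrow> nat \<Rightarrow> bool" where
  "loose S z n \<longleftrightarrow> z \<in> S \<and> equimatchable S n \<and> equimatchable (S - {z}) n"

definition separated :: "'a set \<Rightarrow> 'a set \<Rightarrow> bool" where
  "separated X Y \<longleftrightarrow> X \<inter> Y = {} \<and> (\<forall>e\<in>E. e \<subseteq> X \<union> Y \<longrightarrow> e \<subseteq> X \<or> e \<subseteq> Y)"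

text \<open>\<open>A \<union> B\<close> is closed under adjacency within \<open>S\<close>, hence a
  union of components of the graph on \<open>S\<close>, properly 2-coloured by \<open>A\<close> and
  \<open>B\<close>. Components may stay uncoloured, since nothing is known about those without a
  loose vertex.\<close>

definition colouring :: "'a set \<Rightarrow> 'a set \<Rightarrow> 'a set \<Rightarrow> bool" where
  "colouring S A B \<longleftrightarrow> A \<inter> B = {} \<and> A \<union> B \<subseteq> S \<and>
     (\<forall>u\<in>S. \<forall>v\<in>S. {u, v} \<in> E \<longrightarrow> u \<in> A \<union> B \<longrightarrow> u \<in> A \<and> v \<in> B \<or> u \<in> B \<and> v \<in> A)"

section \<open>Edges and matchings\<close>

lemma colouring_edge:
  assumes "colouring S A B" "{u, v} \<in> E" "u \<in> S" "v \<in> S" "u \<in> A \<union> B"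
  shows "u \<in> A \<and> v \<in> B \<or> u \<in> B \<and> v \<in> A"
  using assms unfolding colouring_def by blast

lemma edge_cases:
  assumes "e \<in> E"
  obtains u v where "e = {u, v}" "u \<noteq> v"
  using card_edge[OF assms] by (auto simp: card_2_iff)

lemma edge_neq: "{u, v} \<in> E \<Longrightarrow> u \<noteq> v"
  using card_edge[of "{u, v}"] by auto

lemma edge_nonempty: "e \<in> E \<Longrightarrow> e \<noteq> {}"
  using card_edge by fastforce

lemma edge_sym: "{u, v} \<in> E \<Longrightarrow> {v, u} \<in> E"
  by (simp add: insert_commute)

lemma matching_finite: "matching S M \<Longrightarrow> finite M"
  using finite_E finite_subset unfolding matching_def by blast

lemma matching_mono: "matching S M \<Longrightarrow> S \<subseteq> S' \<Longrightarrow> matching S' M"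
  unfolding matching_def by blast

lemma matching_subset: "matching S M \<Longrightarrow> N \<subseteq> M \<Longrightarrow> matching S N"
  unfolding matching_def by (auto intro: pairwise_subset)

lemma matching_partner:
  assumes "matching S M" "v \<in> \<Union>M"
  obtains w where "{v, w} \<in> M" "{v, w} \<in> E" "w \<noteq> v" "w \<in> S" "v \<in> S"
proof -
  obtain e where e: "e \<in> M" "v \<in> e" using assms by auto
  then have eE: "e \<in> E" "e \<subseteq> S" using assms by (auto simp: matching_def)
  then obtain a b where ab: "e = {a, b}" "a \<noteq> b" by (metis edge_cases)
  define w where "w = (if v = a then b else a)"
  have "e = {v, w}" "w \<noteq> v" using ab e(2) by (auto simp: w_def)
  then show ?thesis using that e eE by simp
qed

lemma matching_disjoint:
  "matching S M \<Longrightarrow> e \<in> M \<Longrightarrow> f \<in> M \<Longrightarrow> v \<in> e \<Longrightarrow> v \<in> f \<Longrightarrow> e = f"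
  unfolding matching_def pairwise_def disjnt_def by blast

lemma matching_insert:
  assumes "matching S M" "{u, v} \<in> E" "u \<in> S" "v \<in> S" "u \<notin> \<Union>M" "v \<notin> \<Union>M"
  shows "matching S (insert {u, v} M)" "card (insert {u, v} M) = Suc (card M)"
proof -
  show "matching S (insert {u, v} M)"
    using assms unfolding matching_def pairwise_insert by (auto simp: disjnt_def)
  have "{u, v} \<notin> M" using assms by auto
  then show "card (insert {u, v} M) = Suc (card M)" using matching_finite[OF assms(1)] by simp
qed

lemma matching_Un:
  assumes "matching X M" "matching Y N" "X \<inter> Y = {}"
  shows "matching (X \<union> Y) (M \<union> N)" "card (M \<union> N) = card M + card N"
proof -
  have d: "e \<inter> f = {}" if "e \<in> M" "f \<in> N" for e f
  proof -
    have "e \<subseteq> X" "f \<subseteq> Y" using that assms(1,2) by (auto simp: matching_def)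
    then show ?thesis using assms(3) by blast
  qed
  have "e \<inter> f = {}" if "e \<in> M \<union> N" "f \<in> M \<union> N" "e \<noteq> f" for e f
  proof -
    have M: "e \<inter> f = {}" if "e \<in> M" "f \<in> M"
      using matching_disjoint[OF assms(1) that] \<open>e \<noteq> f\<close> by auto
    have N: "e \<inter> f = {}" if "e \<in> N" "f \<in> N"
      using matching_disjoint[OF assms(2) that] \<open>e \<noteq> f\<close> by auto
    show ?thesis using that(1,2) M N d[of e f] d[of f e] by (simp add: Int_commute) argo
  qed
  then have "pairwise disjnt (M \<union> N)" by (simp add: pairwise_def disjnt_def)
  moreover have "M \<union> N \<subseteq> E" "\<Union>(M \<union> N) \<subseteq> X \<union> Y" using assms(1,2) by (auto simp: matching_def)
  ultimately show "matching (X \<union> Y) (M \<union> N)" by (simp add: matching_def)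
  have "M \<inter> N = {}" 
  proof (rule ccontr)
    assume "M \<inter> N \<noteq> {}"
    then obtain e where "e \<in> M" "e \<in> N" by auto
    moreover have "e \<noteq> {}" using \<open>e \<in> M\<close> assms edge_nonempty by (auto simp: matching_def)
    ultimately show False using d[of e e] by auto
  qed
  then show "card (M \<union> N) = card M + card N"
    using assms matching_finite by (meson card_Un_disjoint)
qed

lemma matching_remove:
  assumes "matching S M" "{u, v} \<in> M"
  shows "matching (S - {u, v}) (M - {{u, v}})" "card M = Suc (card (M - {{u, v}}))"
    "\<Union>(M - {{u, v}}) = \<Union>M - {u, v}"
proof -
  show U: "\<Union>(M - {{u, v}}) = \<Union>M - {u, v}"
    using matching_disjoint[OF assms(1) _ assms(2)] by blast
  show "matching (S - {u, v}) (M - {{u, v}})"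
    using matching_subset[OF assms(1), of "M - {{u, v}}"] U assms(1) unfolding matching_def by blast
  show "card M = Suc (card (M - {{u, v}}))"
    using assms matching_finite[OF assms(1)] by (metis card_Suc_Diff1)
qed

lemma separated_edge: "separated X Y \<Longrightarrow> e \<in> E \<Longrightarrow> e \<subseteq> X \<union> Y \<Longrightarrow> e \<subseteq> X \<or> e \<subseteq> Y"
  by (simp add: separated_def)

lemma max_matching_edge: "max_matching S M \<Longrightarrow> e \<in> E \<Longrightarrow> e \<subseteq> S \<Longrightarrow> e \<inter> \<Union>M \<noteq> {}"
  by (simp add: max_matching_def)

lemma edge_at:
  assumes "e \<in> E" "v \<in> e"
  shows "\<exists>w. e = {v, w}"
proof -
  obtain a b where "e = {a, b}" using assms(1) by (metis edge_cases)
  then show ?thesis using assms(2) by auto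
qed

text \<open>Only one edge of \<open>M\<close> lies outside \<open>N\<close>, so both newly covered
  vertices are its ends. This is how new adjacencies are found later.\<close>

lemma matching_one_edge:
  assumes N: "N \<subseteq> M" "card M = Suc (card N)" and M: "matching S M"
    and p: "p \<in> \<Union>M" "p \<notin> \<Union>N" and q: "q \<in> \<Union>M" "q \<notin> \<Union>N" and "p \<noteq> q"
  shows "{p, q} \<in> M"
proof -
  obtain e f where ef: "e \<in> M" "p \<in> e" "f \<in> M" "q \<in> f" using p q by auto
  have "finite M" using M by (rule matching_finite)
  then have "card (M - N) = 1" using N by (subst card_Diff_subset) (auto intro: finite_subset)
  moreover have "e \<in> M - N" "f \<in> M - N" using ef p q by auto
  ultimately have "e = f" by (metis card_1_singletonE singletonD)
  moreover have "e \<in> E" using ef M by (auto simp: matching_def)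
  then obtain u v where "e = {u, v}" by (metis edge_cases)
  ultimately have "e = {p, q}" using ef \<open>p \<noteq> q\<close> by auto
  then show ?thesis using ef by simp
qed

lemma max_matching_imp: "max_matching S M \<Longrightarrow> matching S M"
  by (simp add: max_matching_def)

section \<open>Maximal matchings and equimatchable sets\<close>

lemma max_matching_extend:
  assumes "matching S M"
  obtains N where "M \<subseteq> N" "max_matching S N"
proof -
  let ?X = "{N. matching S N}"
  have "finite ?X" by (rule finite_subset[of _ "Pow E"]) (auto simp: matching_def finite_E)
  then obtain N where N: "N \<in> ?X" "M \<subseteq> N" "\<forall>b\<in>?X. N \<subseteq> b \<longrightarrow> N = b"
    using finite_has_maximal2[of ?X M] assms by auto
  have "max_matching S N" unfolding max_matching_def
  proof (intro conjI ballI impI)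
    show "matching S N" using N by simp
    fix e assume e: "e \<in> E" "e \<subseteq> S"
    show "e \<inter> \<Union>N \<noteq> {}"
    proof
      assume d: "e \<inter> \<Union>N = {}"
      obtain u v where uv: "e = {u, v}" using e(1) edge_cases by metis
      have "matching S (insert e N)"
        using matching_insert(1)[of S N u v] N(1) e d uv by auto
      then have "e \<in> N" using N(3) by blast
      then show False using d uv by auto
    qed
  qed
  then show ?thesis using that N by blast
qed

lemma max_matching_ex: obtains M where "max_matching S M"
  using max_matching_extend[of S "{}"] by (auto simp: matching_def)

lemma equimatchable_le:
  assumes "equimatchable S n" "matching S M"
  shows "card M \<le> n"
  by (metis assms card_mono equimatchable_def matching_finite max_matching_extend max_matching_imp)

text \<open>A maximal extension of \<open>M\<close> has only \<open>n\<close> edges, so it adds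
  nothing to \<open>M\<close>.\<close>

lemma equimatchable_full:
  assumes "equimatchable S n" "matching S M" "n \<le> card M"
  shows "max_matching S M"
proof -
  obtain N where N: "M \<subseteq> N" "max_matching S N" using assms max_matching_extend by metis
  then have "card N = n" using assms equimatchable_def by blast
  then have "N = M" using N assms(3) matching_finite[OF max_matching_imp[OF N(2)]]
    by (metis card_seteq)
  then show ?thesis using N by simp
qed

text \<open>A matching that is too small is not maximal. Counting arguments below use this to
  produce an edge between uncovered vertices.\<close>

lemma equimatchable_uncovered:
  assumes "equimatchable S n" "matching S M" "card M < n"
  obtains u v where "{u, v} \<in> E" "u \<in> S" "v \<in> S" "u \<notin> \<Union>M" "v \<notin> \<Union>M"
proof -
  have "\<not> max_matching S M" using assms by (auto simp: equimatchable_def)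
  then obtain e where e: "e \<in> E" "e \<subseteq> S" "e \<inter> \<Union>M = {}"
    using assms by (auto simp: max_matching_def)
  obtain u v where "e = {u, v}" using e(1) edge_cases by metis
  then show ?thesis using that e by auto
qed

lemma max_matching_insert:
  assumes "max_matching (S - {u, v}) M" "{u, v} \<in> E" "u \<in> S" "v \<in> S"
  shows "max_matching S (insert {u, v} M)" "card (insert {u, v} M) = Suc (card M)"
proof -
  have M: "matching (S - {u, v}) M" using assms by (simp add: max_matching_def)
  then have un: "u \<notin> \<Union>M" "v \<notin> \<Union>M" by (auto simp: matching_def)
  have M': "matching S M" by (rule matching_mono[OF M]) auto
  show "card (insert {u, v} M) = Suc (card M)"
    by (rule matching_insert(2)[OF M' assms(2-4) un])
  have "matching S (insert {u, v} M)"
    by (rule matching_insert(1)[OF M' assms(2-4) un])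
  moreover have "e \<inter> \<Union>(insert {u, v} M) \<noteq> {}" if "e \<in> E" "e \<subseteq> S" for e
  proof (cases "e \<inter> {u, v} = {}")
    case True
    then have "e \<subseteq> S - {u, v}" using that by auto
    then have "e \<inter> \<Union>M \<noteq> {}" using assms(1) that by (auto simp: max_matching_def)
    then show ?thesis by auto
  qed auto
  ultimately show "max_matching S (insert {u, v} M)" by (auto simp: max_matching_def)
qed

text \<open>Adding \<open>uv\<close> turns each maximal matching of \<open>S - {u, v}\<close> into
  one of \<open>S\<close> with one more edge.\<close>

lemma equimatchable_remove:
  assumes "equimatchable S n" "{u, v} \<in> E" "u \<in> S" "v \<in> S"
  shows "equimatchable (S - {u, v}) (n - 1)" "n \<ge> 1"
proof -
  have *: "Suc (card M) = n" if "max_matching (S - {u, v}) M" for M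
    using max_matching_insert[OF that assms(2-4)] assms(1) by (simp add: equimatchable_def)
  then show "equimatchable (S - {u, v}) (n - 1)" by (force simp: equimatchable_def)
  obtain M where "max_matching (S - {u, v}) M" by (rule max_matching_ex)
  then show "n \<ge> 1" using * by force
qed

section \<open>Parts without edges between them\<close>

lemma max_matching_Un:
  assumes "separated X Y" "max_matching X M" "max_matching Y N"
  shows "max_matching (X \<union> Y) (M \<union> N)" "card (M \<union> N) = card M + card N"
proof -
  have XY: "X \<inter> Y = {}" using assms by (simp add: separated_def)
  note m = matching_Un[OF max_matching_imp[OF assms(2)] max_matching_imp[OF assms(3)] XY]
  show "card (M \<union> N) = card M + card N" by (rule m)
  show "max_matching (X \<union> Y) (M \<union> N)" unfolding max_matching_def
  proof (intro conjI ballI impI)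
    fix e assume e: "e \<in> E" "e \<subseteq> X \<union> Y"
    then have "e \<subseteq> X \<or> e \<subseteq> Y" using assms(1) by (auto simp: separated_def)
    then have "e \<inter> \<Union>M \<noteq> {} \<or> e \<inter> \<Union>N \<noteq> {}"
      using assms(2,3) e(1) by (auto simp: max_matching_def)
    then show "e \<inter> \<Union>(M \<union> N) \<noteq> {}" by auto
  qed (rule m)
qed

lemma separated_sym: "separated X Y \<Longrightarrow> separated Y X"
  by (auto simp: separated_def Un_commute)

lemma max_matching_restrict:
  assumes "separated X Y" "max_matching (X \<union> Y) M"
  shows "max_matching X {e\<in>M. e \<subseteq> X}"
proof -
  have m: "matching (X \<union> Y) M" by (rule max_matching_imp[OF assms(2)])
  have "matching X {e\<in>M. e \<subseteq> X}" using m unfolding matching_def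
    by (auto simp: pairwise_def)
  moreover have "e \<inter> \<Union>{e\<in>M. e \<subseteq> X} \<noteq> {}" if e: "e \<in> E" "e \<subseteq> X" for e
  proof -
    have "e \<inter> \<Union>M \<noteq> {}" using e assms(2) by (auto simp: max_matching_def)
    then obtain f v where f: "f \<in> M" "v \<in> f" "v \<in> e" by auto
    then have "f \<in> E" "f \<subseteq> X \<union> Y" using m by (auto simp: matching_def)
    then have "f \<subseteq> X \<or> f \<subseteq> Y" using assms(1) by (auto simp: separated_def)
    then have "f \<subseteq> X" using f e assms(1) by (auto simp: separated_def)
    then show ?thesis using f by auto
  qed
  ultimately show ?thesis by (auto simp: max_matching_def)
qed

text \<open>Maximal matchings of the two parts combine freely; with one of them fixed, the size of
  the other is determined.\<close>

lemma equimatchable_split: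
  assumes "separated X Y" "equimatchable (X \<union> Y) n"
  obtains a b where "equimatchable X a" "equimatchable Y b" "a + b = n"
proof -
  obtain M N where MN: "max_matching X M" "max_matching Y N" by (metis max_matching_ex)
  have *: "card M' + card N' = n" if "max_matching X M'" "max_matching Y N'" for M' N'
    using max_matching_Un[OF assms(1) that] assms(2) by (simp add: equimatchable_def)
  have "equimatchable X (card M)" "equimatchable Y (card N)"
    unfolding equimatchable_def using *[OF _ MN(2)] *[OF MN(1)] *[OF MN] by (auto; fastforce)+
  then show ?thesis using that *[OF MN] by blast
qed

section \<open>Loose vertices and bipartiteness\<close>

lemma loose_max_matching:
  assumes "loose S z n" "max_matching (S - {z}) M"
  shows "max_matching S M" "card M = n"
proof -
  show c: "card M = n" using assms by (auto simp: loose_def equimatchable_def)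
  have "matching S M" by (rule matching_mono[OF max_matching_imp[OF assms(2)]]) auto
  \<comment> \<open>\<open>M\<close> already has the number of edges required in \<open>S\<close>,
    although it avoids \<open>z\<close>.\<close>
  then show "max_matching S M" using equimatchable_full c assms(1) by (auto simp: loose_def)
qed

text \<open>\<open>M\<close> is maximal in \<open>S\<close> too, so it meets \<open>zc\<close>, and
  it can do so only in \<open>c\<close>.\<close>

lemma loose_covers:
  assumes "loose S z n" "max_matching (S - {z}) M" "{z, c} \<in> E" "c \<in> S"
  shows "c \<in> \<Union>M"
proof -
  have "z \<notin> \<Union>M" using assms(2) by (auto simp: max_matching_def matching_def)
  moreover have "{z, c} \<inter> \<Union>M \<noteq> {}"
    by (rule max_matching_edge[OF loose_max_matching(1)[OF assms(1,2)] assms(3)])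
      (use assms in \<open>simp add: loose_def\<close>)
  ultimately show ?thesis by auto
qed

text \<open>Removing an edge at \<open>z\<close> passes looseness on along any path of length two, so it
  reaches every vertex at the end of a path of even length from \<open>z\<close>.\<close>

lemma loose_step:
  assumes "loose S z n" "{z, c} \<in> E" "c \<in> S" "{c, b} \<in> E" "b \<in> S" "b \<noteq> z"
  shows "loose (S - {z, c}) b (n - 1)"
proof -
  have "b \<noteq> c" "c \<noteq> z" using edge_neq assms by blast+
  have "equimatchable (S - {z, c}) (n - 1)"
    using equimatchable_remove[of S n z c] assms by (simp add: loose_def)
  moreover have "equimatchable (S - {z} - {c, b}) (n - 1)"
    by (rule equimatchable_remove(1)) (use assms(1,3-6) \<open>c \<noteq> z\<close> in \<open>simp_all add: loose_def\<close>)
  moreover have "S - {z} - {c, b} = S - {z, c} - {b}" by auto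
  ultimately show ?thesis using assms \<open>b \<noteq> c\<close> by (simp add: loose_def)
qed

text \<open>If \<open>N\<close> missed a vertex of \<open>A\<close>, exchanging its edges inside \<open>A \<union> B\<close> for those of \<open>M\<close> would
  enlarge it.\<close>

lemma colouring_essential:
  assumes col: "colouring S A B" and eq: "equimatchable S n" and fin: "finite S"
    and M: "max_matching S M" "A \<subseteq> \<Union>M" and N: "max_matching S N"
  shows "A \<subseteq> \<Union>N"
proof (rule ccontr)
  assume "\<not> A \<subseteq> \<Union>N"
  then obtain a where a: "a \<in> A" "a \<notin> \<Union>N" by auto
  let ?K = "A \<union> B"
  let ?in = "\<lambda>M. {e\<in>M. e \<subseteq> ?K}" and ?out = "\<lambda>M. {e\<in>M. \<not> e \<subseteq> ?K}"
  have mM: "matching S M" and mN: "matching S N" using M N by (auto simp: max_matching_def)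
  have finA: "finite A" using col fin by (meson colouring_def finite_Un finite_subset)
  \<comment> \<open>As \<open>?K\<close> is closed under adjacency in \<open>S\<close>, an edge that
    is not inside \<open>?K\<close> avoids it altogether. Hence the edges inside and outside
    \<open>?K\<close> can be exchanged independently.\<close>
  have out: "e \<subseteq> S - ?K" if "matching S L" "e \<in> ?out L" for L e
  proof -
    have e: "e \<in> E" "e \<subseteq> S" using that by (auto simp: matching_def)
    then obtain u v where uv: "e = {u, v}" by (metis edge_cases)
    then show ?thesis using colouring_edge[OF col, of u v] colouring_edge[OF col, of v u] that(2) e
      by (auto simp: insert_commute)
  qed
  have hit: "\<exists>u. e \<inter> A = {u}" if "matching S L" "e \<in> ?in L" for L e
  proof -
    have "e \<in> E" "e \<subseteq> S" using that by (auto simp: matching_def)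
    then obtain u v where uv: "e = {u, v}" by (metis edge_cases)
    then have "u \<in> A \<and> v \<in> B \<or> u \<in> B \<and> v \<in> A"
      using \<open>e \<in> E\<close> \<open>e \<subseteq> S\<close> that(2) colouring_edge[OF col, of u v] by simp
    moreover have "A \<inter> B = {}" using col by (simp add: colouring_def)
    ultimately have "e \<inter> A = {u} \<or> e \<inter> A = {v}" using uv by blast
    then show ?thesis by blast
  qed
  \<comment> \<open>Each edge inside \<open>?K\<close> has exactly one end in \<open>A\<close>, so
    these edges are counted by the covered vertices of \<open>A\<close>.\<close>
  have card_in: "card (?in L) = card (A \<inter> \<Union>L)" if L: "matching S L" for L
  proof -
    define g where "g e = (THE u. e \<inter> A = {u})" for e
    have g: "e \<inter> A = {g e}" if e: "e \<in> ?in L" for e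
    proof -
      obtain u where u: "e \<inter> A = {u}" using hit[OF L e] by blast
      then have "g e = u" unfolding g_def by (intro the_equality) auto
      then show ?thesis using u by simp
    qed
    have "bij_betw g (?in L) (A \<inter> \<Union>L)" unfolding bij_betw_def
    proof
      show "inj_on g (?in L)"
      proof (rule inj_onI)
        fix e f assume ef: "e \<in> ?in L" "f \<in> ?in L" "g e = g f"
        then have "g e \<in> e" "g e \<in> f" using g by blast+
        then show "e = f" using matching_disjoint[OF L] ef by blast
      qed
      show "g ` ?in L = A \<inter> \<Union>L"
      proof
        show "g ` ?in L \<subseteq> A \<inter> \<Union>L" using g by blast
        show "A \<inter> \<Union>L \<subseteq> g ` ?in L"
        proof
          fix v assume v: "v \<in> A \<inter> \<Union>L"
          then obtain e where e: "e \<in> L" "v \<in> e" by auto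
          then have "e \<in> ?in L" using out[OF L, of e] v by auto
          then show "v \<in> g ` ?in L" using g[of e] e v by blast
        qed
      qed
    qed
    then show ?thesis by (rule bij_betw_same_card)
  qed
  have "card (?in N) < card (?in M)"
  proof -
    have "A \<inter> \<Union>N \<subset> A" "A \<inter> \<Union>M = A" using a M by auto
    then show ?thesis using card_in[OF mM] card_in[OF mN] finA by (simp add: psubset_card_mono)
  qed
  moreover have cN: "card N = card (?in N) + card (?out N)"
    using matching_finite[OF mN] by (subst card_Un_disjoint[symmetric]) (auto intro: arg_cong[where f = card])
  moreover have "matching (?K \<union> (S - ?K)) (?in M \<union> ?out N)"
    "card (?in M \<union> ?out N) = card (?in M) + card (?out N)"
  proof -
    have 1: "matching ?K (?in M)" using mM unfolding matching_def by (auto simp: pairwise_def)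
    have 2: "matching (S - ?K) (?out N)" using out[OF mN] matching_subset[OF mN, of "?out N"]
      unfolding matching_def by blast
    show "matching (?K \<union> (S - ?K)) (?in M \<union> ?out N)"
      "card (?in M \<union> ?out N) = card (?in M) + card (?out N)"
      using matching_Un[OF 1 2] by auto
  qed
  moreover have "?K \<union> (S - ?K) = S" using col by (auto simp: colouring_def)
  ultimately have "card N < card (?in M \<union> ?out N)" "matching S (?in M \<union> ?out N)" by auto
  moreover have "card N = n" using eq N by (auto simp: equimatchable_def)
  ultimately show False using equimatchable_le[OF eq] by fastforce
qed

text \<open>Strong induction on the size of \<open>S\<close>. For an edge \<open>zc\<close>, the
  induction hypothesis is applied in \<open>S - {z, c}\<close> to each remaining neighbour of
  \<open>c\<close>, and then to \<open>z\<close> in what is left of \<open>S\<close> without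
  \<open>c\<close> and the vertices coloured so far. Carrying along that \<open>A\<close> is always
  covered and each vertex of \<open>B\<close> is sometimes missed keeps the colourings
  compatible.\<close>

lemma loose_bipartite:
  assumes "loose S z n" "finite S"
    "\<And>u v w. \<lbrakk>u \<in> S; v \<in> S; w \<in> S; {u, v} \<in> E; {v, w} \<in> E\<rbrakk> \<Longrightarrow> {u, w} \<notin> E"
  obtains A B where "z \<in> B" "colouring S A B" "\<And>M. max_matching S M \<Longrightarrow> A \<subseteq> \<Union>M"
    "\<And>b. b \<in> B \<Longrightarrow> \<exists>M. max_matching S M \<and> b \<notin> \<Union>M"
proof -
  have "\<exists>A B. z \<in> B \<and> colouring S A B \<and> (\<forall>M. max_matching S M \<longrightarrow> A \<subseteq> \<Union>M) \<and>
    (\<forall>b\<in>B. \<exists>M. max_matching S M \<and> b \<notin> \<Union>M)"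
    using assms
  proof (induction "card S" arbitrary: S z n rule: less_induct)
    case less
    note L = less.prems(1) and fin = less.prems(2) and tri = less.prems(3)
    have zS: "z \<in> S" using L by (simp add: loose_def)
    have eqS: "equimatchable S n" "equimatchable (S - {z}) n" using L by (auto simp: loose_def)
    show ?case
    proof (cases "\<exists>c\<in>S. {z, c} \<in> E")
      case False
      obtain M where M: "max_matching S M" by (rule max_matching_ex)
      have "z \<notin> \<Union>M" using matching_partner[OF max_matching_imp[OF M], of z] False by metis
      moreover have "colouring S {} {z}" using False zS by (auto simp: colouring_def)
      ultimately show ?thesis using M by (intro exI[of _ "{}"] exI[of _ "{z}"]) auto
    next
      case True
      then obtain c where c: "c \<in> S" "{z, c} \<in> E" by auto
      have cz: "c \<noteq> z" using edge_neq[OF c(2)] by simp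
      define H where "H = S - {z, c}"
      have cardH: "card H < card S" unfolding H_def
        by (rule psubset_card_mono[OF fin]) (use c in auto)
      have eqH: "equimatchable H (n - 1)" and n1: "n \<ge> 1"
        using equimatchable_remove[OF eqS(1) c(2) zS c(1)] by (auto simp: H_def)
      define Nc where "Nc = {b\<in>H. {c, b} \<in> E}"
      have HS: "H \<subseteq> S" by (auto simp: H_def)
      have "\<exists>A B. b \<in> B \<and> colouring H A B \<and> (\<forall>M. max_matching H M \<longrightarrow> A \<subseteq> \<Union>M) \<and>
          (\<forall>b\<in>B. \<exists>M. max_matching H M \<and> b \<notin> \<Union>M)" if "b \<in> Nc" for b
      proof (rule less.hyps[OF cardH])
        show "loose H b (n - 1)" unfolding H_def
          by (rule loose_step[OF L c(2,1)]) (use that in \<open>auto simp: Nc_def H_def\<close>)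
        show "finite H" using fin by (simp add: H_def)
        show "{u, w} \<notin> E" if "u \<in> H" "v \<in> H" "w \<in> H" "{u, v} \<in> E" "{v, w} \<in> E" for u v w
          using tri[of u v w] that HS by blast
      qed
      then obtain Af Bf where AB: "\<And>b. b \<in> Nc \<Longrightarrow> b \<in> Bf b" "\<And>b. b \<in> Nc \<Longrightarrow> colouring H (Af b) (Bf b)"
        "\<And>b M. b \<in> Nc \<Longrightarrow> max_matching H M \<Longrightarrow> Af b \<subseteq> \<Union>M"
        "\<And>b v. b \<in> Nc \<Longrightarrow> v \<in> Bf b \<Longrightarrow> \<exists>M. max_matching H M \<and> v \<notin> \<Union>M"
        by metis
      define A0 B0 where "A0 = (\<Union>b\<in>Nc. Af b)" and "B0 = (\<Union>b\<in>Nc. Bf b)"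
      have A0: "A0 \<subseteq> \<Union>M" if "max_matching H M" for M using AB(3) that by (auto simp: A0_def)
      have B0: "\<exists>M. max_matching H M \<and> v \<notin> \<Union>M" if "v \<in> B0" for v
        using AB(4) that by (auto simp: B0_def)
      have NcB0: "Nc \<subseteq> B0" using AB(1) by (auto simp: B0_def)
      have col0: "colouring H A0 B0" unfolding colouring_def
      proof (intro conjI ballI impI)
        \<comment> \<open>Colourings obtained from different \<open>b\<close> cannot conflict: every
          maximal matching of \<open>H\<close> covers \<open>A0\<close>, while each vertex of
          \<open>B0\<close> is missed by one of them.\<close>
        show "A0 \<inter> B0 = {}" using A0 B0 by blast
        have "Af b \<union> Bf b \<subseteq> H" if "b \<in> Nc" for b using AB(2)[OF that] by (simp add: colouring_def)
        then show "A0 \<union> B0 \<subseteq> H" by (auto simp: A0_def B0_def)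
        fix u v assume uv: "u \<in> H" "v \<in> H" "{u, v} \<in> E" "u \<in> A0 \<union> B0"
        then obtain b where b: "b \<in> Nc" "u \<in> Af b \<union> Bf b" by (auto simp: A0_def B0_def)
        show "u \<in> A0 \<and> v \<in> B0 \<or> u \<in> B0 \<and> v \<in> A0"
          using colouring_edge[OF AB(2)[OF b(1)] uv(3,1,2) b(2)] b(1) by (auto simp: A0_def B0_def)
      qed
      define K0 where "K0 = A0 \<union> B0"
      have K0H: "K0 \<subseteq> H" using col0 by (auto simp: K0_def colouring_def)
      \<comment> \<open>Together, \<open>c\<close> and \<open>K0\<close> form the set
        \<open>X\<close>, which is closed under adjacency in \<open>S - {z}\<close>;
        \<open>S2\<close> is the rest of \<open>S\<close> and still contains
        \<open>z\<close>.\<close>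
      define S2 where "S2 = S - {c} - K0"
      have zS2: "z \<in> S2" using zS cz K0H by (auto simp: S2_def H_def)
      have cardS2: "card S2 < card S"
        by (rule psubset_card_mono[OF fin]) (use c in \<open>auto simp: S2_def\<close>)
      have S2S: "S2 \<subseteq> S" by (auto simp: S2_def)
      define X where "X = insert c K0"
      have closedX: "v \<in> X" if "u \<in> X" "{u, v} \<in> E" "v \<in> S - {z}" for u v
      proof (cases "u = c \<or> v = c")
        case True
        then show ?thesis using that NcB0 edge_neq[OF that(2)] by (auto simp: X_def K0_def Nc_def H_def)
      next
        case False
        then have "u \<in> K0" "u \<in> H" "v \<in> H" using that K0H by (auto simp: X_def H_def)
        then show ?thesis using colouring_edge[OF col0 that(2)] by (auto simp: X_def K0_def)
      qed
      have sep: "separated X (S2 - {z})" unfolding separated_def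
      proof (intro conjI ballI impI)
        show "X \<inter> (S2 - {z}) = {}" by (auto simp: X_def S2_def)
        fix e assume e: "e \<in> E" "e \<subseteq> X \<union> (S2 - {z})"
        obtain u v where uv: "e = {u, v}" using e(1) by (metis edge_cases)
        have "X \<union> (S2 - {z}) \<subseteq> S - {z}" using K0H c cz by (auto simp: X_def S2_def H_def)
        then show "e \<subseteq> X \<or> e \<subseteq> S2 - {z}"
          using e uv closedX[of u v] closedX[of v u] by (auto simp: insert_commute)
      qed
      have XS2: "X \<union> (S2 - {z}) = S - {z}" using K0H c cz by (auto simp: X_def S2_def H_def)
      obtain a k where ak: "equimatchable X a" "equimatchable (S2 - {z}) k" "a + k = n"
        using equimatchable_split[OF sep] eqS(2) XS2 by metis
      obtain N where N: "max_matching X N" by (rule max_matching_ex)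
      have cardN: "card N = a" using N ak by (simp add: equimatchable_def)
      have Xz: "X \<inter> S2 = {}" by (auto simp: X_def S2_def)
      have XS2': "X \<union> S2 = S" using XS2 zS2 zS by auto
      \<comment> \<open>\<open>N\<close> extends to a maximal matching of \<open>S - {z}\<close>,
        which covers all neighbours of the loose vertex \<open>z\<close>; those in \<open>X\<close>
        can only be covered by \<open>N\<close>.\<close>
      have Ncov: "v \<in> \<Union>N" if "v \<in> X" "{z, v} \<in> E" for v
      proof -
        obtain M2 where M2: "max_matching (S2 - {z}) M2" by (rule max_matching_ex)
        have "max_matching (S - {z}) (N \<union> M2)" using max_matching_Un(1)[OF sep N M2] XS2 by simp
        then have "v \<in> \<Union>(N \<union> M2)" using loose_covers[OF L] that XS2' by blast
        moreover have "v \<notin> \<Union>M2" using M2 that Xz by (auto simp: max_matching_def matching_def)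
        ultimately show ?thesis by simp
      qed
      \<comment> \<open>An edge between \<open>X\<close> and \<open>S2\<close> must end in
        \<open>z\<close>, so its other end is covered by \<open>N\<close> whatever \<open>M2\<close>
        is.\<close>
      have NM: "max_matching S (N \<union> M2)" "card (N \<union> M2) = a + card M2" if M2: "max_matching S2 M2" for M2
      proof -
        note m = matching_Un[OF max_matching_imp[OF N] max_matching_imp[OF M2] Xz]
        show "card (N \<union> M2) = a + card M2" using m cardN by simp
        show "max_matching S (N \<union> M2)" unfolding max_matching_def
        proof (intro conjI ballI impI)
          show "matching S (N \<union> M2)" using m XS2' by simp
          fix e assume e: "e \<in> E" "e \<subseteq> S"
          obtain u v where uv: "e = {u, v}" using e(1) by (metis edge_cases)
          have *: "e \<inter> \<Union>(N \<union> M2) \<noteq> {}" if "e = {u, v}" "u \<in> X" "v \<in> S2" for u v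
          proof (cases "v = z")
            case True
            then show ?thesis using Ncov[of u] that e by (auto simp: insert_commute)
          next
            case False
            then have "v \<in> X" using closedX[of u v] that e S2S by auto
            then show ?thesis using that Xz by auto
          qed
          consider "e \<subseteq> X" | "e \<subseteq> S2" | "u \<in> X" "v \<in> S2" | "v \<in> X" "u \<in> S2"
            using uv e XS2' by auto
          then show "e \<inter> \<Union>(N \<union> M2) \<noteq> {}"
          proof cases
            case 1
            then have "e \<inter> \<Union>N \<noteq> {}" using N e unfolding max_matching_def by blast
            then show ?thesis by blast
          next
            case 2
            then have "e \<inter> \<Union>M2 \<noteq> {}" using M2 e unfolding max_matching_def by blast
            then show ?thesis by blast
          next
            case 3 then show ?thesis using *[OF uv] by simp
          next
            case 4 then show ?thesis using *[of v u] uv by (auto simp: insert_commute)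
          qed
        qed
      qed
      \<comment> \<open>\<open>N\<close> contributes \<open>a\<close> edges both with and without
        \<open>z\<close>, so \<open>S2\<close> and \<open>S2 - {z}\<close> need the same number
        \<open>k\<close>, and \<open>z\<close> is loose in \<open>S2\<close>.\<close>
      have eqS2: "equimatchable S2 k" unfolding equimatchable_def
      proof (intro allI impI)
        fix M2 assume M2: "max_matching S2 M2"
        then have "card (N \<union> M2) = n" using NM eqS by (auto simp: equimatchable_def)
        then show "card M2 = k" using NM(2)[OF M2] ak by simp
      qed
      have L2: "loose S2 z k" using zS2 eqS2 ak by (simp add: loose_def)
      have "\<exists>A B. z \<in> B \<and> colouring S2 A B \<and> (\<forall>M. max_matching S2 M \<longrightarrow> A \<subseteq> \<Union>M) \<and>
          (\<forall>b\<in>B. \<exists>M. max_matching S2 M \<and> b \<notin> \<Union>M)"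
      proof (rule less.hyps[OF cardS2 L2])
        show "finite S2" using fin by (simp add: S2_def)
        show "{u, w} \<notin> E" if "u \<in> S2" "v \<in> S2" "w \<in> S2" "{u, v} \<in> E" "{v, w} \<in> E" for u v w
          using tri[of u v w] that S2S by blast
      qed
      then obtain A2 B2 where zB2: "z \<in> B2" and col2: "colouring S2 A2 B2"
        and A2: "\<And>M. max_matching S2 M \<Longrightarrow> A2 \<subseteq> \<Union>M"
        and B2: "\<And>b. b \<in> B2 \<Longrightarrow> \<exists>M. max_matching S2 M \<and> b \<notin> \<Union>M" by metis
      have AB2: "A2 \<inter> B2 = {}" "A2 \<union> B2 \<subseteq> S2" using col2 by (auto simp: colouring_def)
      define A B where "A = insert c (A0 \<union> A2)" and "B = B0 \<union> B2"
      \<comment> \<open>A neighbour \<open>v\<close> of \<open>z\<close> outside \<open>A0\<close>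
        is missed by some maximal matching of \<open>H\<close>, which has \<open>n - 1\<close>
        edges. Extending it in \<open>S - {z}\<close> adds one edge, and that edge has to cover both
        \<open>c\<close> and \<open>v\<close>; then \<open>z\<close>, \<open>c\<close>,
        \<open>v\<close> form a triangle.\<close>
      have zA0: "v \<in> A0" if v: "v \<in> K0" "{z, v} \<in> E" for v
      proof (rule ccontr)
        assume "v \<notin> A0"
        then obtain M where M: "max_matching H M" "v \<notin> \<Union>M" using B0 v by (auto simp: K0_def)
        have vH: "v \<in> H" using v K0H by auto
        have cardM: "card M = n - 1" using M eqH by (auto simp: equimatchable_def)
        have mM: "matching (S - {z}) M"
          by (rule matching_mono[OF max_matching_imp[OF M(1)]]) (auto simp: H_def)
        obtain M' where M': "M \<subseteq> M'" "max_matching (S - {z}) M'" by (rule max_matching_extend[OF mM])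
        have cov: "c \<in> \<Union>M'" "v \<in> \<Union>M'"
          using loose_covers[OF L M'(2)] c v vH HS by auto
        have "c \<notin> \<Union>M" using M(1) by (auto simp: max_matching_def matching_def H_def)
        have "card M' = Suc (card M)" using M' eqS cardM n1 by (simp add: equimatchable_def)
        moreover have "c \<noteq> v" using vH by (auto simp: H_def)
        ultimately have "{c, v} \<in> M'"
          using matching_one_edge[OF M'(1) _ max_matching_imp[OF M'(2)]] cov M(2) \<open>c \<notin> \<Union>M\<close> by blast
        then have "{c, v} \<in> E" using M' by (auto simp: max_matching_def matching_def)
        then show False using tri[of z c v] zS c v vH HS by auto
      qed
      have col: "colouring S A B" unfolding colouring_def
      proof (intro conjI ballI impI)
        show "A \<inter> B = {}" using AB2 K0H col0 c cz unfolding A_def B_def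
          by (auto simp: S2_def K0_def H_def colouring_def)
        show "A \<union> B \<subseteq> S" using AB2 K0H c HS S2S by (auto simp: A_def B_def K0_def)
        fix u v assume uv: "u \<in> S" "v \<in> S" "{u, v} \<in> E" "u \<in> A \<union> B"
        have vu: "{v, u} \<in> E" using uv by (simp add: insert_commute)
        have "u \<noteq> v" using edge_neq uv by blast
        have "z \<notin> K0" using K0H by (auto simp: H_def)
        have S2u: "u \<in> S2 \<longleftrightarrow> u \<noteq> c \<and> u \<notin> K0" "v \<in> S2 \<longleftrightarrow> v \<noteq> c \<and> v \<notin> K0" using uv by (auto simp: S2_def)
        have K: "w \<in> B0" if "{c, w} \<in> E" "w \<in> S" "w \<noteq> z" for w
          using that NcB0 edge_neq[OF that(1)] by (auto simp: Nc_def H_def)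
        consider "u = c" | "v = c" | "u = z" "v \<in> K0" | "v = z" "u \<in> K0"
          | "u \<in> H" "v \<in> H" "u \<in> K0" | "u \<in> H" "v \<in> H" "v \<in> K0" | "u \<in> S2" "v \<in> S2"
          using S2u uv \<open>z \<notin> K0\<close> unfolding H_def by blast
        then show "u \<in> A \<and> v \<in> B \<or> u \<in> B \<and> v \<in> A"
        proof cases
          case 1 then show ?thesis using K[of v] uv zB2 by (auto simp: A_def B_def)
        next
          case 2 then show ?thesis using K[of u] vu uv zB2 by (auto simp: A_def B_def)
        next
          case 3 then show ?thesis using zA0 uv zB2 by (auto simp: A_def B_def)
        next
          case 4 then show ?thesis using zA0 vu zB2 by (auto simp: A_def B_def)
        next
          case 5 then show ?thesis using colouring_edge[OF col0 uv(3)] by (auto simp: A_def B_def K0_def)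
        next
          case 6 then show ?thesis using colouring_edge[OF col0 vu] by (auto simp: A_def B_def K0_def)
        next
          case 7
          then have "u \<in> A2 \<union> B2" using uv S2u by (auto simp: A_def B_def K0_def)
          then show ?thesis using colouring_edge[OF col2 uv(3) 7] by (auto simp: A_def B_def)
        qed
      qed
      \<comment> \<open>For \<open>B0\<close>, add \<open>zc\<close> to a matching of
        \<open>H\<close>; for \<open>B2\<close>, add \<open>N\<close> to a matching of
        \<open>S2\<close>.\<close>
      have Bmiss: "\<exists>M. max_matching S M \<and> b \<notin> \<Union>M" if b: "b \<in> B" for b
      proof (cases "b \<in> B0")
        case True
        then obtain M where M: "max_matching H M" "b \<notin> \<Union>M" using B0 by blast
        have "b \<in> H" using True K0H by (auto simp: K0_def)
        then show ?thesis using max_matching_insert(1)[of S z c M] M c zS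
          by (intro exI[of _ "insert {z, c} M"]) (auto simp: H_def)
      next
        case False
        then have b2: "b \<in> B2" using b by (simp add: B_def)
        then obtain M where M: "max_matching S2 M" "b \<notin> \<Union>M" using B2 by blast
        have "b \<notin> X" using b2 AB2 Xz by auto
        then have "b \<notin> \<Union>N" using N by (auto simp: max_matching_def matching_def)
        then show ?thesis using NM(1)[OF M(1)] M(2) by (intro exI[of _ "N \<union> M"]) auto
      qed
      \<comment> \<open>By \<open>colouring_essential\<close>, one maximal matching covering
        \<open>A\<close> is enough. One that avoids \<open>z\<close> will do: it covers
        \<open>c\<close>, dropping its edge at \<open>c\<close> leaves a maximal matching of
        \<open>H\<close>, and its part in \<open>S2\<close> is maximal there.\<close>
      obtain M where M: "max_matching (S - {z}) M" by (rule max_matching_ex)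
      have mM: "matching (S - {z}) M" and MS: "max_matching S M" and cM: "card M = n"
        using M max_matching_imp loose_max_matching[OF L M] by auto
      have "A \<subseteq> \<Union>M"
      proof -
        have cM': "c \<in> \<Union>M" using loose_covers[OF L M] c by auto
        then obtain b where b: "{c, b} \<in> M" by (rule matching_partner[OF mM])
        have "matching H (M - {{c, b}})"
          by (rule matching_mono[OF matching_remove(1)[OF mM b]]) (auto simp: H_def)
        then have "max_matching H (M - {{c, b}})"
          using equimatchable_full[OF eqH] matching_remove(2)[OF mM b] cM by auto
        then have "A0 \<subseteq> \<Union>M" using A0 by blast
        moreover have "max_matching (S2 - {z}) {e\<in>M. e \<subseteq> S2 - {z}}"
          by (rule max_matching_restrict[OF separated_sym[OF sep]]) (use M XS2 in \<open>simp add: Un_commute\<close>)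
        then have "max_matching S2 {e\<in>M. e \<subseteq> S2 - {z}}" by (rule loose_max_matching(1)[OF L2])
        then have "A2 \<subseteq> \<Union>M" using A2 by blast
        ultimately show ?thesis using cM' by (simp add: A_def)
      qed
      then have "A \<subseteq> \<Union>M'" if "max_matching S M'" for M'
        using colouring_essential[OF col eqS(1) fin MS _ that] by simp
      then show ?thesis using col Bmiss zB2 by (intro exI[of _ A] exI[of _ B]) (auto simp: B_def)
    qed
  qed
  then show ?thesis using that by blast
qed

text \<open>A maximal matching avoiding \<open>z\<close> covers \<open>A\<close>, and so pairs it
  injectively with vertices of \<open>B - {z}\<close>.\<close>

lemma loose_card_less:
  assumes L: "loose S z n" and fin: "finite S" and zB: "z \<in> B" and col: "colouring S A B"
    and A: "\<And>M. max_matching S M \<Longrightarrow> A \<subseteq> \<Union>M"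
  shows "card A < card B"
proof -
  obtain M where M: "max_matching (S - {z}) M" by (rule max_matching_ex)
  have mM: "matching (S - {z}) M" using M by (rule max_matching_imp)
  have cov: "A \<subseteq> \<Union>M" using A loose_max_matching(1)[OF L M] by simp
  have "\<exists>b. {a, b} \<in> M \<and> b \<in> B - {z}" if a: "a \<in> A" for a
  proof -
    obtain b where b: "{a, b} \<in> M" "{a, b} \<in> E" "b \<in> S - {z}" "a \<in> S - {z}"
      using matching_partner[OF mM, of a] cov a by blast
    moreover have "A \<inter> B = {}" using col by (simp add: colouring_def)
    ultimately show ?thesis using colouring_edge[OF col b(2)] a by blast
  qed
  then obtain g where g: "\<And>a. a \<in> A \<Longrightarrow> {a, g a} \<in> M \<and> g a \<in> B - {z}" by metis
  have "inj_on g A"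
  proof (rule inj_onI)
    fix a b assume ab: "a \<in> A" "b \<in> A" "g a = g b"
    have "{a, g a} = {b, g b}"
      using g[OF ab(1)] g[OF ab(2)] ab(3) by (intro matching_disjoint[OF mM, of _ _ "g a"]) auto
    then show "a = b" using ab(3) by (auto simp: doubleton_eq_iff)
  qed
  moreover have "finite B" using col fin by (meson colouring_def finite_Un finite_subset)
  ultimately have "card A \<le> card (B - {z})" using g by (intro card_inj_on_le[of g]) auto
  also have "\<dots> < card B" using zB \<open>finite B\<close> by (intro psubset_card_mono) auto
  finally show ?thesis .
qed

section \<open>Minimal edge dominating sets\<close>

definition min_dominating :: "'a set set \<Rightarrow> 'a set set \<Rightarrow> bool" where
  "min_dominating D F \<longleftrightarrow> F \<subseteq> D \<and> (\<forall>e\<in>D. e \<inter> \<Union>F \<noteq> {}) \<and>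
     (\<forall>f\<in>F. \<exists>e\<in>D. \<forall>g\<in>F. e \<inter> g \<noteq> {} \<longrightarrow> g = f)"

text \<open>The private edge \<open>e\<close> is dominated by \<open>F\<close>, hence met by
  \<open>f\<close> and by no other member; this is what prevents \<open>f\<close> from being
  dropped.\<close>

lemma min_dominating_private:
  assumes "min_dominating D F" "f \<in> F"
  obtains e where "e \<in> D" "\<forall>g\<in>F. e \<inter> g \<noteq> {} \<longrightarrow> g = f"
  using assms by (auto simp: min_dominating_def)

definition well :: "'a set \<Rightarrow> nat \<Rightarrow> bool" where
  "well S n \<longleftrightarrow> (\<forall>F. min_dominating {e\<in>E. e \<subseteq> S} F \<longrightarrow> card F = n)"

text \<open>Every edge of a matching is its own private edge.\<close>

lemma max_matching_min_dominating:
  assumes "max_matching S M"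
  shows "min_dominating {e\<in>E. e \<subseteq> S} M"
proof -
  have M: "matching S M" using assms by (rule max_matching_imp)
  have sub: "M \<subseteq> {e\<in>E. e \<subseteq> S}" using M by (auto simp: matching_def)
  have "\<exists>e\<in>{e\<in>E. e \<subseteq> S}. \<forall>g\<in>M. e \<inter> g \<noteq> {} \<longrightarrow> g = f" if f: "f \<in> M" for f
  proof
    show "f \<in> {e\<in>E. e \<subseteq> S}" using f sub by blast
    show "\<forall>g\<in>M. f \<inter> g \<noteq> {} \<longrightarrow> g = f" using matching_disjoint[OF M _ f] by blast
  qed
  moreover have "\<forall>e\<in>{e\<in>E. e \<subseteq> S}. e \<inter> \<Union>M \<noteq> {}" using assms by (simp add: max_matching_def)
  ultimately show ?thesis using sub by (simp add: min_dominating_def)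
qed

lemma well_equimatchable: "well S n \<Longrightarrow> equimatchable S n"
  by (simp add: well_def equimatchable_def max_matching_min_dominating)

text \<open>Adding \<open>uv\<close> to a minimal dominating set for \<open>S - {u, v}\<close> keeps
  it minimal: \<open>uv\<close> is private to itself, and the old private edges avoid
  \<open>u\<close> and \<open>v\<close>.\<close>

lemma well_remove:
  assumes "well S n" "{u, v} \<in> E" "u \<in> S" "v \<in> S"
  shows "well (S - {u, v}) (n - 1)"
  unfolding well_def
proof (intro allI impI)
  fix F assume F: "min_dominating {e\<in>E. e \<subseteq> S - {u, v}} F"
  then have sub: "F \<subseteq> {e\<in>E. e \<subseteq> S - {u, v}}" by (simp add: min_dominating_def)
  then have uv: "{u, v} \<inter> f = {}" if "f \<in> F" for f using that by blast
  then have notin: "{u, v} \<notin> F" by blast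
  have "min_dominating {e\<in>E. e \<subseteq> S} (insert {u, v} F)"
    unfolding min_dominating_def
  proof (intro conjI ballI)
    show "insert {u, v} F \<subseteq> {e\<in>E. e \<subseteq> S}" using sub assms by auto
    fix e assume e: "e \<in> {e\<in>E. e \<subseteq> S}"
    show "e \<inter> \<Union>(insert {u, v} F) \<noteq> {}"
    proof (cases "e \<inter> {u, v} = {}")
      case True
      then have "e \<in> {e\<in>E. e \<subseteq> S - {u, v}}" using e by auto
      then have "e \<inter> \<Union>F \<noteq> {}" using F unfolding min_dominating_def by blast
      then show ?thesis by auto
    qed auto
  next
    fix f assume f: "f \<in> insert {u, v} F"
    show "\<exists>e\<in>{e\<in>E. e \<subseteq> S}. \<forall>g\<in>insert {u, v} F. e \<inter> g \<noteq> {} \<longrightarrow> g = f"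
    proof (cases "f = {u, v}")
      case True
      then show ?thesis using uv assms by (intro bexI[of _ "{u, v}"]) auto
    next
      case False
      then obtain e where e: "e \<in> {e\<in>E. e \<subseteq> S - {u, v}}" "\<forall>g\<in>F. e \<inter> g \<noteq> {} \<longrightarrow> g = f"
        using min_dominating_private[OF F, of f] f by auto
      then show ?thesis by (intro bexI[of _ e]) auto
    qed
  qed
  then have "card (insert {u, v} F) = n" using assms(1) by (simp add: well_def)
  moreover have "finite F" using sub finite_E by (auto intro: finite_subset)
  ultimately show "card F = n - 1" using notin by simp
qed

text \<open>A smallest dominating subset under inclusion has private edges, since dropping any
  member leaves some edge undominated.\<close>

lemma min_dominating_subset:
  assumes "F \<subseteq> D" "D \<subseteq> E" "\<And>e. e \<in> D \<Longrightarrow> e \<inter> \<Union>F \<noteq> {}"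
  obtains F' where "F' \<subseteq> F" "min_dominating D F'"
proof -
  let ?X = "{F'. F' \<subseteq> F \<and> (\<forall>e\<in>D. e \<inter> \<Union>F' \<noteq> {})}"
  have "finite F" using assms finite_E by (meson finite_subset)
  then have "finite ?X" by simp
  moreover have "F \<in> ?X" using assms by simp
  ultimately obtain F' where F': "F' \<in> ?X" "\<forall>b\<in>?X. b \<subseteq> F' \<longrightarrow> F' = b"
    using finite_has_minimal2[of ?X F] by auto
  have "\<exists>e\<in>D. \<forall>g\<in>F'. e \<inter> g \<noteq> {} \<longrightarrow> g = f" if f: "f \<in> F'" for f
  proof (rule ccontr)
    assume n: "\<not> ?thesis"
    have "e \<inter> \<Union>(F' - {f}) \<noteq> {}" if eD: "e \<in> D" for e
    proof -
      obtain g where g: "g \<in> F'" "e \<inter> g \<noteq> {}" "g \<noteq> f" using n eD by metis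
      then have "g \<subseteq> \<Union>(F' - {f})" by (intro Union_upper) simp
      then show ?thesis using g(2) by (metis Int_mono order_refl subset_empty)
    qed
    then have "F' - {f} \<in> ?X" using F'(1) by auto
    then have "F' = F' - {f}" using bspec[OF F'(2), of "F' - {f}"] by simp
    then show False using f by blast
  qed
  moreover have "F' \<subseteq> F" "\<forall>e\<in>D. e \<inter> \<Union>F' \<noteq> {}" using F' by auto
  ultimately have "min_dominating D F'" using assms(1) by (simp add: min_dominating_def subset_trans)
  then show ?thesis using that \<open>F' \<subseteq> F\<close> by blast
qed

lemma equimatchable_unique: "equimatchable S m \<Longrightarrow> equimatchable S n \<Longrightarrow> m = n"
  by (metis equimatchable_def max_matching_ex)

end

section \<open>Graphs with exactly one triangle\<close>

text \<open>\<open>C\<close> stands for the vertices of the given component, attached to the rest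
  only through \<open>z\<close>. Writing the common size as \<open>Suc n\<close> leaves
  \<open>n\<close> after the ends of one edge are deleted. Connectedness is stated through sets
  closed under adjacency, the form in which it is applied.\<close>

locale triangle_graph = edge_set E for E :: "'a set set" +
  fixes V C :: "'a set" and x y z :: 'a and n :: nat
  assumes finite_V: "finite V" and edges_V: "e \<in> E \<Longrightarrow> e \<subseteq> V"
    and xy: "{x, y} \<in> E" and yz: "{y, z} \<in> E" and xz: "{x, z} \<in> E"
    and triangle: "\<lbrakk>{u, v} \<in> E; {v, w} \<in> E; {u, w} \<in> E\<rbrakk> \<Longrightarrow> {u, v, w} = {x, y, z}"
    and well_V: "well V (Suc n)"
    and connected: "\<lbrakk>K \<noteq> {}; K \<subseteq> V; \<And>u v. \<lbrakk>u \<in> K; {u, v} \<in> E\<rbrakk> \<Longrightarrow> v \<in> K\<rbrakk> \<Longrightarrow> K = V"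
    and C: "C \<noteq> {}" "C \<subseteq> V - {x, y, z}"
    and C_nbr: "\<lbrakk>u \<in> C; {u, v} \<in> E\<rbrakk> \<Longrightarrow> v \<in> insert z C"
begin

abbreviation U where "U \<equiv> V - {x, y, z}"
text \<open>The part of \<open>U\<close> that contains all neighbours of \<open>x\<close> and
  \<open>y\<close> off the triangle.\<close>

abbreviation R where "R \<equiv> V - {x, y, z} - C"

lemma distinct: "x \<noteq> y" "y \<noteq> z" "x \<noteq> z"
  using edge_neq xy yz xz by blast+

lemma xyz_V: "x \<in> V" "y \<in> V" "z \<in> V"
  using edges_V xy yz by blast+

lemma edge_V: "{u, v} \<in> E \<Longrightarrow> u \<in> V \<and> v \<in> V"
  using edges_V by blast

text \<open>The symmetry by which results about the neighbours of \<open>x\<close> carry over to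
  \<open>y\<close>.\<close>

lemma swap: "triangle_graph E V C y x z n"
proof unfold_locales
  show "{u, v, w} = {y, x, z}" if "{u, v} \<in> E" "{v, w} \<in> E" "{u, w} \<in> E" for u v w
    using triangle[OF that] by (simp add: insert_commute)
  show "C \<subseteq> V - {y, x, z}" using C by auto
  show "K = V" if "K \<noteq> {}" "K \<subseteq> V" "\<And>u v. \<lbrakk>u \<in> K; {u, v} \<in> E\<rbrakk> \<Longrightarrow> v \<in> K" for K
    using connected that by blast
qed (use finite_V edges_V edge_sym[OF xy] yz xz well_V C C_nbr in auto)

lemma swap_sets: "V - {y, x, z} = U" by auto

lemma notin_C: "x \<notin> C" "y \<notin> C" "z \<notin> C"
  using C by auto

lemma C_z: obtains c where "c \<in> C" "{z, c} \<in> E"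
proof -
  have "C \<noteq> V" using C xyz_V by auto
  then obtain u v where uv: "u \<in> C" "{u, v} \<in> E" "v \<notin> C"
    using connected[of C] C by blast
  then have "v = z" using C_nbr by blast
  then show ?thesis using that uv by (simp add: insert_commute)
qed

section \<open>Matchings off the triangle\<close>

lemma separated_C: "K \<subseteq> C \<Longrightarrow> L \<subseteq> R \<Longrightarrow> separated K L"
proof (unfold separated_def, intro conjI ballI impI)
  assume KL: "K \<subseteq> C" "L \<subseteq> R"
  then show "K \<inter> L = {}" by auto
  fix e assume e: "e \<in> E" "e \<subseteq> K \<union> L"
  then obtain u v where uv: "e = {u, v}" by (metis edge_cases)
  have *: False if "a \<in> K" "b \<in> L" "{a, b} \<in> E" for a b
    using C_nbr[of a b] that KL by blast
  show "e \<subseteq> K \<or> e \<subseteq> L" using *[of u v] *[of v u] e uv by (auto simp: insert_commute)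
qed

lemma C_Un_R: "C \<union> R = U" using C by auto

lemma equimatchable_drop:
  shows "equimatchable (V - {y, z}) n" "equimatchable (V - {x, z}) n" "equimatchable (V - {x, y}) n"
  using well_equimatchable[OF well_remove[OF well_V yz]] well_equimatchable[OF well_remove[OF well_V xz]]
    well_equimatchable[OF well_remove[OF well_V xy]] xyz_V by auto

text \<open>In \<open>V - {x, z}\<close>, which is \<open>U\<close> with \<open>y\<close> added,
  \<open>n\<close> edges are required. So \<open>M\<close> leaves an edge uncovered there, and by
  maximality in \<open>U\<close> that edge ends in \<open>y\<close>.\<close>

lemma missed_nbr:
  assumes M: "max_matching U M" and "card M < n"
  obtains v where "v \<in> R" "{y, v} \<in> E" "v \<notin> \<Union>M"
proof -
  have "matching (V - {x, z}) M" by (rule matching_mono[OF max_matching_imp[OF M]]) auto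
  from equimatchable_uncovered[OF equimatchable_drop(2) this assms(2)]
  obtain u v where uv: "{u, v} \<in> E" "u \<in> V - {x, z}" "v \<in> V - {x, z}" "u \<notin> \<Union>M" "v \<notin> \<Union>M" by metis
  have "\<not> {u, v} \<subseteq> U" using M uv unfolding max_matching_def by blast
  then have "u = y \<or> v = y" using uv by auto
  moreover have "w \<in> R" if "{y, w} \<in> E" "w \<in> V - {x, z}" for w
    using that C_nbr[of w y] edge_neq[OF that(1)] edge_sym[OF that(1)] C distinct by blast
  ultimately show ?thesis using that uv edge_sym[OF uv(1)] by blast
qed

lemma common_nbr: "{x, v} \<in> E \<Longrightarrow> {y, v} \<in> E \<Longrightarrow> v = z"
  using triangle[OF xy, of v] edge_neq[of x v] edge_neq[of y v] by auto

lemma equimatchable_U: "equimatchable U n"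
  unfolding equimatchable_def
proof (intro allI impI)
  fix M assume M: "max_matching U M"
  have "matching (V - {x, y}) M" by (rule matching_mono[OF max_matching_imp[OF M]]) auto
  then have le: "card M \<le> n" using equimatchable_le[OF equimatchable_drop(3)] by simp
  show "card M = n"
  proof (rule ccontr)
    assume "card M \<noteq> n"
    then have less: "card M < n" using le by simp
    obtain y' where y': "y' \<in> R" "{y, y'} \<in> E" "y' \<notin> \<Union>M" using missed_nbr[OF M less] .
    have M': "max_matching (V - {y, x, z}) M" using M by (simp add: swap_sets)
    obtain x' where x': "x' \<in> V - {y, x, z} - C" "{x, x'} \<in> E" "x' \<notin> \<Union>M" using triangle_graph.missed_nbr[OF swap M' less] .
    obtain c where c: "c \<in> C" "{z, c} \<in> E" by (rule C_z)
    have neq: "x' \<noteq> y'" using common_nbr x' y' by blast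
    \<comment> \<open>Only the part of \<open>M\<close> in \<open>R\<close> is kept, so
      \<open>x'\<close> and \<open>y'\<close> stay uncovered; in \<open>C\<close> it is replaced by
      a matching avoiding \<open>c\<close>. The result \<open>L\<close> is maximal in
      \<open>V - {z, c} - {x, y}\<close> and has \<open>n - 1\<close> edges, so adding
      \<open>xx'\<close>, \<open>yy'\<close> and \<open>zc\<close> gives \<open>n + 2\<close>, one
      too many.\<close>
    let ?MR = "{e\<in>M. e \<subseteq> R}"
    have MR: "max_matching R ?MR"
      by (rule max_matching_restrict[OF separated_sym[OF separated_C[OF subset_refl subset_refl]]])
        (use M C_Un_R in \<open>simp add: Un_commute\<close>)
    obtain MC where MC: "max_matching (C - {c}) MC" by (rule max_matching_ex)
    have sep: "separated (C - {c}) R" by (rule separated_C) auto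
    define L where "L = MC \<union> ?MR"
    have L: "max_matching (C - {c} \<union> R) L" unfolding L_def by (rule max_matching_Un[OF sep MC MR])
    have "equimatchable (V - {z, c} - {x, y}) (n - 1)"
      using well_equimatchable[OF well_remove[OF well_remove[OF well_V c(2)] xy]] xyz_V distinct c C
      by auto
    moreover have "V - {z, c} - {x, y} = C - {c} \<union> R" using c C by auto
    ultimately have cardL: "card L = n - 1" using L by (simp add: equimatchable_def)
    have mL: "matching V L"
      by (rule matching_mono[OF max_matching_imp[OF L]]) (use C in auto)
    have sub: "\<Union>L \<subseteq> C - {c} \<union> R" using L by (auto simp: max_matching_def matching_def)
    have "x' \<notin> \<Union>MC" "y' \<notin> \<Union>MC" using MC x' y' by (auto simp: max_matching_def matching_def)
    then have x'L: "x' \<notin> \<Union>L" and y'L: "y' \<notin> \<Union>L" using x' y' by (auto simp: L_def)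
    have 1: "matching V (insert {x, x'} L)" "card (insert {x, x'} L) = Suc (card L)"
      by (rule matching_insert[OF mL x'(2)]; use x'L x' xyz_V sub C in blast)+
    have 2: "matching V (insert {y, y'} (insert {x, x'} L))"
      "card (insert {y, y'} (insert {x, x'} L)) = Suc (card (insert {x, x'} L))"
      by (rule matching_insert[OF 1(1) y'(2)]; use x' y'L y' xyz_V sub C neq distinct in auto)+
    have 3: "matching V (insert {z, c} (insert {y, y'} (insert {x, x'} L)))"
      "card (insert {z, c} (insert {y, y'} (insert {x, x'} L))) = Suc (card (insert {y, y'} (insert {x, x'} L)))"
      by (rule matching_insert[OF 2(1) c(2)]; use x' y' xyz_V sub C c distinct in auto)+
    have "card (insert {z, c} (insert {y, y'} (insert {x, x'} L))) \<le> Suc n"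
      by (rule equimatchable_le[OF well_equimatchable[OF well_V] 3(1)])
    then show False using 1 2 3 cardL less by simp
  qed
qed

text \<open>Adding one vertex of the triangle to \<open>U\<close> gives \<open>V\<close> without the
  ends of the opposite edge, which also needs \<open>n\<close> edges. So that vertex is loose
  there.\<close>

lemma U_covers:
  assumes "max_matching U M" "v \<in> U" "{s, v} \<in> E" "s \<in> {x, y, z}"
  shows "v \<in> \<Union>M"
proof -
  have "loose (insert s U) s n"
  proof -
    have "insert x U = V - {y, z}" "insert y U = V - {x, z}" "insert z U = V - {x, y}"
      using distinct xyz_V by auto
    then have "equimatchable (insert s U) n" using assms(4) equimatchable_drop
      by (elim insertE) simp_all
    moreover have "insert s U - {s} = U" using assms(4) by auto
    ultimately show ?thesis using equimatchable_U by (simp add: loose_def)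
  qed
  moreover have "insert s U - {s} = U" using assms(4) by auto
  ultimately show ?thesis using loose_covers[of "insert s U" s n M v] assms by auto
qed

lemma R_covers:
  assumes M: "max_matching R M" and "v \<in> R" "{s, v} \<in> E" "s \<in> {x, y}"
  shows "v \<in> \<Union>M"
proof -
  obtain N where N: "max_matching C N" by (rule max_matching_ex)
  have "max_matching U (N \<union> M)"
    using max_matching_Un(1)[OF separated_C[OF subset_refl subset_refl] N M] C_Un_R by simp
  then have "v \<in> \<Union>(N \<union> M)" using U_covers[of "N \<union> M" v s] assms by blast
  moreover have "v \<notin> \<Union>N" using assms N by (auto simp: max_matching_def matching_def)
  ultimately show ?thesis by auto
qed

section \<open>Neighbours of \<open>x\<close> and \<open>y\<close> off the triangle\<close>

lemma parts:
  obtains a r where "equimatchable C a" "equimatchable R r" "a + r = n"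
  using equimatchable_split[OF separated_C[OF subset_refl subset_refl], of n] equimatchable_U C_Un_R
  by metis

text \<open>Deleting the ends of \<open>yz\<close> and \<open>xx'\<close> leaves \<open>C\<close>
  and \<open>R - {x'}\<close>; the share of \<open>C\<close> in the count is known, and the rest
  follows by subtraction.\<close>

lemma equimatchable_R_remove:
  assumes "x' \<in> R" "{x, x'} \<in> E" "equimatchable R r"
  shows "equimatchable (R - {x'}) (r - 1)" "r \<ge> 1"
proof -
  obtain a r' where ar: "equimatchable C a" "equimatchable R r'" "a + r' = n" by (rule parts)
  have r: "r' = r" using equimatchable_unique ar assms by blast
  have e: "equimatchable (V - {y, z} - {x, x'}) (n - 1)" "n \<ge> 1"
    using equimatchable_remove[OF equimatchable_drop(1) assms(2)] assms(1) xyz_V distinct by auto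
  moreover have "V - {y, z} - {x, x'} = C \<union> (R - {x'})" using assms C by auto
  moreover have "separated C (R - {x'})" by (rule separated_C) auto
  ultimately obtain a' b where ab: "equimatchable C a'" "equimatchable (R - {x'}) b" "a' + b = n - 1"
    using equimatchable_split by metis
  have "a' = a" using equimatchable_unique ab ar by blast
  then have "b = r - 1" "r \<ge> 1" using ab ar r e by auto
  then show "equimatchable (R - {x'}) (r - 1)" "r \<ge> 1" using ab by auto
qed

text \<open>Delete \<open>z\<close>, \<open>c\<close>, \<open>x\<close>, \<open>x'\<close>, after
  which \<open>n - 1\<close> edges are required. \<open>N\<close> with a maximal matching of
  \<open>C - {c}\<close> is one short, and the uncovered edge must end in \<open>y\<close>; its
  other end is \<open>y'\<close>. Extending \<open>N\<close> in \<open>R\<close> adds one edge,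
  which has to cover both \<open>x'\<close> and \<open>y'\<close>.\<close>

lemma nbr_of_nbr_missed:
  assumes x': "x' \<in> R" "{x, x'} \<in> E" and N: "max_matching (R - {x'}) N"
  obtains y' where "y' \<in> R" "{y, y'} \<in> E" "{x', y'} \<in> E" "y' \<notin> \<Union>N"
proof -
  obtain a r where ar: "equimatchable C a" "equimatchable R r" "a + r = n" by (rule parts)
  have r1: "r \<ge> 1" and cardN: "card N = r - 1"
    using equimatchable_R_remove[OF x' ar(2)] N by (auto simp: equimatchable_def)
  obtain c where c: "c \<in> C" "{z, c} \<in> E" by (rule C_z)
  have eq1: "equimatchable (V - {z, c} - {x, y}) (n - 1)"
    using well_equimatchable[OF well_remove[OF well_remove[OF well_V c(2)] xy]] xyz_V distinct c C
    by auto
  have V1: "V - {z, c} - {x, y} = C - {c} \<union> R" using c C by auto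
  have sep: "separated (C - {c}) R" by (rule separated_C) auto
  obtain a2 r2 where a2: "equimatchable (C - {c}) a2" "equimatchable R r2" "a2 + r2 = n - 1"
    using equimatchable_split[OF sep] eq1 V1 by metis
  have r2: "r2 = r" using equimatchable_unique ar a2 by blast
  have eq2: "equimatchable (V - {z, c} - {x, x'}) (n - 1)"
    using well_equimatchable[OF well_remove[OF well_remove[OF well_V c(2)] x'(2)]] xyz_V distinct c C x'(1)
    by auto
  obtain MC where MC: "max_matching (C - {c}) MC" by (rule max_matching_ex)
  have sep': "separated (C - {c}) (R - {x'})" by (rule separated_C) auto
  define L where "L = MC \<union> N"
  have L: "max_matching (C - {c} \<union> (R - {x'})) L" "card L = a2 + (r - 1)"
    using max_matching_Un[OF sep' MC N] MC a2 cardN by (auto simp: L_def equimatchable_def)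
  have "matching (V - {z, c} - {x, x'}) L"
    by (rule matching_mono[OF max_matching_imp[OF L(1)]]) (use c x'(1) notin_C C(2) in auto)
  moreover have "card L < n - 1" using L(2) a2(3) r2 r1 by simp
  ultimately obtain u v where uv: "{u, v} \<in> E" "u \<in> V - {z, c} - {x, x'}" "v \<in> V - {z, c} - {x, x'}"
    "u \<notin> \<Union>L" "v \<notin> \<Union>L"
    using equimatchable_uncovered[OF eq2] by metis
  have "\<not> {u, v} \<subseteq> C - {c} \<union> (R - {x'})" using L(1) uv unfolding max_matching_def by blast
  then have "u = y \<or> v = y" using uv by blast
  moreover have "w \<in> R" if "{y, w} \<in> E" "w \<in> V - {x, z}" for w
    using that C_nbr[of w y] edge_neq[OF that(1)] edge_sym[OF that(1)] C distinct by blast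
  ultimately obtain y' where y': "y' \<in> R" "{y, y'} \<in> E" "y' \<notin> \<Union>L"
    using uv edge_sym[OF uv(1)] by blast
  have y'N: "y' \<notin> \<Union>N" using y' by (auto simp: L_def)
  have mN: "matching R N" by (rule matching_mono[OF max_matching_imp[OF N]]) auto
  obtain N' where N': "N \<subseteq> N'" "max_matching R N'" by (rule max_matching_extend[OF mN])
  have "card N' = Suc (card N)" using N' ar(2) cardN r1 by (simp add: equimatchable_def)
  moreover have "x' \<in> \<Union>N'" using R_covers[OF N'(2) x'] by simp
  moreover have "y' \<in> \<Union>N'" using R_covers[OF N'(2) y'(1,2)] by simp
  moreover have "x' \<notin> \<Union>N" using N by (auto simp: max_matching_def matching_def)
  moreover have "x' \<noteq> y'" using common_nbr x' y' by blast
  ultimately have "{x', y'} \<in> N'" using matching_one_edge[OF N'(1) _ max_matching_imp[OF N'(2)]] y'N by blast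
  then have "{x', y'} \<in> E" using N' by (auto simp: max_matching_def matching_def)
  then show ?thesis using that y' y'N by blast
qed

text \<open>A maximal matching \<open>N\<close> of \<open>R - {x', w}\<close> is also maximal in
  \<open>R - {x'}\<close>, so it misses a common neighbour \<open>y'\<close> of \<open>y\<close> and
  \<open>x'\<close>. With \<open>x'w\<close> added it is maximal in \<open>R\<close> and covers
  \<open>y'\<close>, which leaves only \<open>y' = w\<close>.\<close>

lemma nbr_of_nbr:
  assumes x': "x' \<in> R" "{x, x'} \<in> E" and w: "w \<in> R" "{x', w} \<in> E"
  shows "{y, w} \<in> E"
proof (rule ccontr)
  assume nw: "{y, w} \<notin> E"
  obtain a r where ar: "equimatchable C a" "equimatchable R r" "a + r = n" by (rule parts)
  obtain N where N: "max_matching (R - {x', w}) N" by (rule max_matching_ex)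
  have "equimatchable (R - {x', w}) (r - 1)"
    using equimatchable_remove(1)[OF ar(2) w(2) x'(1) w(1)] .
  then have cardN: "card N = r - 1" using N by (simp add: equimatchable_def)
  have "matching (R - {x'}) N" by (rule matching_mono[OF max_matching_imp[OF N]]) auto
  then have "max_matching (R - {x'}) N"
    using equimatchable_full equimatchable_R_remove(1)[OF x' ar(2)] cardN by simp
  then obtain y' where y': "y' \<in> R" "{y, y'} \<in> E" "{x', y'} \<in> E" "y' \<notin> \<Union>N"
    by (rule nbr_of_nbr_missed[OF x'])
  have "max_matching R (insert {x', w} N)" by (rule max_matching_insert(1)[OF N w(2) x'(1) w(1)])
  then have "y' \<in> \<Union>(insert {x', w} N)" using R_covers y' by blast
  then show False using y' nw edge_neq by auto
qed

lemma swap_nbr_of_nbr: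
  assumes "y' \<in> R" "{y, y'} \<in> E" "w \<in> R" "{y', w} \<in> E"
  shows "{x, w} \<in> E"
  using triangle_graph.nbr_of_nbr[OF swap, of y' w] assms by (simp add: swap_sets)

lemma matched_nbr:
  assumes M: "max_matching R M" and x1: "{x1, y1} \<in> M" "{x, x1} \<in> E"
  shows "x1 \<in> R" "y1 \<in> R" "{x1, y1} \<in> E" "{y, y1} \<in> E"
proof -
  show 1: "x1 \<in> R" "y1 \<in> R" "{x1, y1} \<in> E"
    using M x1 by (auto simp: max_matching_def matching_def)
  show "{y, y1} \<in> E" by (rule nbr_of_nbr[OF 1(1) x1(2) 1(2,3)])
qed

text \<open>In \<open>V - {z, c}\<close>, exchange \<open>x1y1\<close> and \<open>x2y2\<close> for
  \<open>yy1\<close> and \<open>xx2\<close>. The matching obtained is one edge short, and the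
  uncovered edge can only join the two freed vertices \<open>x1\<close> and
  \<open>y2\<close>.\<close>

lemma cross_edge:
  assumes M: "max_matching R M" and x1: "{x1, y1} \<in> M" "{x, x1} \<in> E"
    and x2: "{x2, y2} \<in> M" "{x, x2} \<in> E" and neq: "x1 \<noteq> x2"
  shows "{x1, y2} \<in> E"
proof -
  obtain a r where ar: "equimatchable C a" "equimatchable R r" "a + r = n" by (rule parts)
  note p1 = matched_nbr[OF M x1] and p2 = matched_nbr[OF M x2]
  have xy': "x1 \<noteq> y1" "x1 \<noteq> y2" "x2 \<noteq> y1" "x2 \<noteq> y2"
    using common_nbr[of x1] common_nbr[of x2] p1 p2 x1 x2 by auto
  have mM: "matching R M" by (rule max_matching_imp[OF M])
  have "y1 \<noteq> y2" using matching_disjoint[OF mM x1(1) x2(1), of y1] neq xy' by (auto simp: doubleton_eq_iff)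
  note neqs = xy' \<open>y1 \<noteq> y2\<close> neq
  obtain c where c: "c \<in> C" "{z, c} \<in> E" by (rule C_z)
  have eq1: "equimatchable (V - {z, c}) n"
    using well_equimatchable[OF well_remove[OF well_V c(2)]] xyz_V c C by auto
  have eq2: "equimatchable (V - {z, c} - {x, y}) (n - 1)" "n \<ge> 1"
    using equimatchable_remove[OF eq1 xy] xyz_V distinct c notin_C by auto
  have V1: "V - {z, c} - {x, y} = C - {c} \<union> R" using c C by auto
  have sep: "separated (C - {c}) R" by (rule separated_C) auto
  obtain a2 r2 where a2: "equimatchable (C - {c}) a2" "equimatchable R r2" "a2 + r2 = n - 1"
    using equimatchable_split[OF sep] eq2 V1 by metis
  have r2: "r2 = r" using equimatchable_unique ar a2 by blast
  obtain MC where MC: "max_matching (C - {c}) MC" by (rule max_matching_ex)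
  have mMC: "matching (C - {c}) MC" by (rule max_matching_imp[OF MC])
  define N where "N = M - {{x1, y1}} - {{x2, y2}}"
  have n1: "matching (R - {x1, y1}) (M - {{x1, y1}})" "card M = Suc (card (M - {{x1, y1}}))"
    "\<Union>(M - {{x1, y1}}) = \<Union>M - {x1, y1}"
    by (rule matching_remove[OF mM x1(1)])+
  have x2': "{x2, y2} \<in> M - {{x1, y1}}" using x2 neqs by (auto simp: doubleton_eq_iff)
  have n2: "matching (R - {x1, y1} - {x2, y2}) N" "card (M - {{x1, y1}}) = Suc (card N)"
    "\<Union>N = \<Union>M - {x1, y1} - {x2, y2}"
    unfolding N_def n1(3)[symmetric] by (rule matching_remove[OF n1(1) x2'])+
  have cM: "card M = r" using M ar by (simp add: equimatchable_def)
  have sepN: "(C - {c}) \<inter> (R - {x1, y1} - {x2, y2}) = {}" by auto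
  define L where "L = MC \<union> N"
  have L: "matching ((C - {c}) \<union> (R - {x1, y1} - {x2, y2})) L" "card L = a2 + card N"
    using matching_Un[OF mMC n2(1) sepN] MC a2 by (auto simp: L_def equimatchable_def)
  have UL: "\<Union>L = \<Union>MC \<union> \<Union>N" by (auto simp: L_def)
  have subL: "\<Union>L \<subseteq> (C - {c}) \<union> (R - {x1, y1} - {x2, y2})" using L by (simp add: matching_def)
  have mL: "matching (V - {z, c}) L" by (rule matching_mono[OF L(1)]) (use C c in auto)
  have un: "y \<notin> \<Union>L" "x \<notin> \<Union>L" "y1 \<notin> \<Union>L" "x2 \<notin> \<Union>L"
    using subL p1(2) p2(1) notin_C by blast+
  have Vs: "y \<in> V - {z, c}" "y1 \<in> V - {z, c}" "x \<in> V - {z, c}" "x2 \<in> V - {z, c}"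
    using p1(2) p2(1) c notin_C distinct xyz_V by auto
  define L1 where "L1 = insert {y, y1} L"
  have L1: "matching (V - {z, c}) L1" "card L1 = Suc (card L)" "\<Union>L1 = {y, y1} \<union> \<Union>L"
    unfolding L1_def using matching_insert[OF mL p1(4) Vs(1,2) un(1,3)] by auto
  have un1: "x \<notin> \<Union>L1" "x2 \<notin> \<Union>L1" using un L1(3) distinct p1(2) p2(1) neqs by auto
  define L2 where "L2 = insert {x, x2} L1"
  have L2: "matching (V - {z, c}) L2" "card L2 = Suc (card L1)" "\<Union>L2 = {x, x2, y, y1} \<union> \<Union>L"
    unfolding L2_def using matching_insert[OF L1(1) x2(2) Vs(3,4) un1] L1(3) by auto
  \<comment> \<open>The count is \<open>a2 + (r - 2) + 2\<close>, that is
    \<open>n - 1\<close>.\<close>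
  have "card L2 < n" using L2(2) L1(2) L(2) n2(2) n1(2) cM a2(3) r2 eq2(2) by simp
  then obtain u v where uv: "{u, v} \<in> E" "u \<in> V - {z, c}" "v \<in> V - {z, c}" "u \<notin> \<Union>L2" "v \<notin> \<Union>L2"
    using equimatchable_uncovered[OF eq1 L2(1)] by metis
  have "{u, v} \<subseteq> C - {c} \<union> R" using uv L2(3) by auto
  then have "{u, v} \<subseteq> C - {c} \<or> {u, v} \<subseteq> R" by (rule separated_edge[OF sep uv(1)])
  moreover have "\<not> {u, v} \<subseteq> C - {c}"
  proof
    assume "{u, v} \<subseteq> C - {c}"
    then have "{u, v} \<inter> \<Union>MC \<noteq> {}" by (rule max_matching_edge[OF MC uv(1)])
    then show False using uv(4,5) L2(3) UL by auto
  qed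
  ultimately have uvR: "u \<in> R" "v \<in> R" by auto
  have notN: "u \<notin> \<Union>N" "v \<notin> \<Union>N" "u \<notin> {x2, y1}" "v \<notin> {x2, y1}" using uv L2(3) UL by auto
  \<comment> \<open>The other end \<open>v\<close> of an edge at \<open>x1\<close> or
    \<open>y2\<close> is a neighbour of \<open>y\<close> or of \<open>x\<close>, so \<open>M\<close>
    covers it; as it is uncovered now, it must be the other freed vertex.\<close>
  have key: "{u, v} = {x1, y2}" if uv: "{u, v} \<in> E" and R: "u \<in> R" "v \<in> R"
    and N: "v \<notin> \<Union>N" "v \<notin> {x2, y1}" and u: "u \<in> {x1, y2}" for u v
  proof -
    have "v \<noteq> u" using edge_neq[OF uv] by simp
    have "\<exists>s\<in>{x, y}. {s, v} \<in> E"
      using nbr_of_nbr[OF R(1) _ R(2) uv] swap_nbr_of_nbr[OF R(1) _ R(2) uv] u x1 p2(4) by auto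
    then have "v \<in> \<Union>M" using R_covers[OF M R(2)] by blast
    then have "v \<in> {x1, y2}" using N n2(3) by auto
    then show ?thesis using u \<open>v \<noteq> u\<close> by auto
  qed
  have "{u, v} \<inter> \<Union>M \<noteq> {}" by (rule max_matching_edge[OF M uv(1)]) (use uvR in simp)
  then have "u \<in> {x1, y2} \<or> v \<in> {x1, y2}" using notN n2(3) by auto
  then have "{u, v} = {x1, y2}"
    using key[OF uv(1) uvR notN(2,4)] key[OF edge_sym[OF uv(1)] uvR(2,1) notN(1,3)]
    by (auto simp: insert_commute)
  then show ?thesis using uv(1) by simp
qed

text \<open>Two neighbours \<open>x1\<close>, \<open>x2\<close> of \<open>x\<close> would give a \<open>K\<^sub>3\<^sub>,\<^sub>3\<close> on \<open>x\<close>, \<open>x1\<close>, \<open>x2\<close>,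
  \<open>y\<close>, \<open>y1\<close>, \<open>y2\<close>; the full star at \<open>x1\<close> together with \<open>yz\<close> then extends to a minimal
  edge dominating set that is too large. This is out of reach for matchings alone.\<close>

lemma unique_nbr:
  assumes x1: "x1 \<in> R" "{x, x1} \<in> E" and x2: "x2 \<in> R" "{x, x2} \<in> E"
  shows "x1 = x2"
proof (rule ccontr)
  assume neq: "x1 \<noteq> x2"
  obtain a r where ar: "equimatchable C a" "equimatchable R r" "a + r = n" by (rule parts)
  obtain M where M: "max_matching R M" by (rule max_matching_ex)
  have mM: "matching R M" by (rule max_matching_imp[OF M])
  have "x1 \<in> \<Union>M" "x2 \<in> \<Union>M" using R_covers[OF M] x1 x2 by auto
  then obtain y1 y2 where y1: "{x1, y1} \<in> M" and y2: "{x2, y2} \<in> M"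
    using matching_partner[OF mM] by metis
  note p1 = matched_nbr[OF M y1 x1(2)] and p2 = matched_nbr[OF M y2 x2(2)]
  have c12: "{x1, y2} \<in> E" by (rule cross_edge[OF M y1 x1(2) y2 x2(2) neq])
  have c21: "{x2, y1} \<in> E" by (rule cross_edge[OF M y2 x2(2) y1 x1(2)]) (use neq in simp)
  have xy': "x1 \<noteq> y1" "x1 \<noteq> y2" "x2 \<noteq> y1" "x2 \<noteq> y2"
    using common_nbr[of x1] common_nbr[of x2] p1 p2 x1 x2 by auto
  have "y1 \<noteq> y2" using matching_disjoint[OF mM y1 y2, of y1] neq xy' by (auto simp: doubleton_eq_iff)
  note neqs = xy' \<open>y1 \<noteq> y2\<close> neq
  obtain MC where MC: "max_matching C MC" by (rule max_matching_ex)
  have mMC: "matching C MC" by (rule max_matching_imp[OF MC])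
  define N where "N = M - {{x1, y1}} - {{x2, y2}}"
  have n1: "matching (R - {x1, y1}) (M - {{x1, y1}})" "card M = Suc (card (M - {{x1, y1}}))"
    "\<Union>(M - {{x1, y1}}) = \<Union>M - {x1, y1}"
    by (rule matching_remove[OF mM y1])+
  have y2': "{x2, y2} \<in> M - {{x1, y1}}" using y2 neqs by (auto simp: doubleton_eq_iff)
  have n2: "matching (R - {x1, y1} - {x2, y2}) N" "card (M - {{x1, y1}}) = Suc (card N)"
    "\<Union>N = \<Union>M - {x1, y1} - {x2, y2}"
    unfolding N_def n1(3)[symmetric] by (rule matching_remove[OF n1(1) y2'])+
  have cM: "card M = r" using M ar by (simp add: equimatchable_def)
  have sepN: "C \<inter> (R - {x1, y1} - {x2, y2}) = {}" by auto
  define L where "L = MC \<union> N"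
  have L: "matching (C \<union> (R - {x1, y1} - {x2, y2})) L" "card L = a + card N"
    using matching_Un[OF mMC n2(1) sepN] MC ar by (auto simp: L_def equimatchable_def)
  have UL: "\<Union>L = \<Union>MC \<union> \<Union>N" by (auto simp: L_def)
  have subL: "\<Union>L \<subseteq> C \<union> (R - {x1, y1} - {x2, y2})" using L(1) by (simp add: matching_def)
  have un: "x \<notin> \<Union>L" "y \<notin> \<Union>L" "z \<notin> \<Union>L" "x1 \<notin> \<Union>L" "x2 \<notin> \<Union>L" "y1 \<notin> \<Union>L" "y2 \<notin> \<Union>L"
    using subL p1(1,2) p2(1,2) notin_C by blast+
  \<comment> \<open>\<open>F\<close> does not cover \<open>x2\<close>, which supplies the private
    edges: \<open>xx2\<close> for \<open>xx1\<close>, \<open>x2y1\<close> for \<open>x1y1\<close>,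
    \<open>x2y2\<close> for \<open>x1y2\<close>, while \<open>yz\<close> is its own.
    \<open>L\<close> has \<open>n - 2\<close> edges, so \<open>F\<close> has \<open>n + 2\<close>
    instead of \<open>n + 1\<close>.\<close>
  let ?S = "{{x, x1}, {x1, y1}, {x1, y2}, {y, z}}"
  define F where "F = ?S \<union> L"
  have far: "e \<inter> g = {}" if "e \<subseteq> {x, y, z, x1, x2, y1, y2}" "g \<in> L" for e g
  proof -
    have "g \<subseteq> \<Union>L" using that(2) by (rule Union_upper)
    then show ?thesis using that(1) un by blast
  qed
  have disj: "?S \<inter> L = {}" using far[of "{x, x1}" "{x, x1}"] far[of "{x1, y1}" "{x1, y1}"]
      far[of "{x1, y2}" "{x1, y2}"] far[of "{y, z}" "{y, z}"] by auto
  have R': "x \<notin> R" "y \<notin> R" "z \<notin> R" by auto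
  have out: "x \<noteq> x1" "x \<noteq> x2" "x \<noteq> y1" "x \<noteq> y2" "y \<noteq> x1" "y \<noteq> x2" "y \<noteq> y1" "y \<noteq> y2"
    "z \<noteq> x1" "z \<noteq> x2" "z \<noteq> y1" "z \<noteq> y2"
    using p1(1,2) p2(1,2) R' by metis+
  have UF: "\<Union>F = {x, y, z, x1, y1, y2} \<union> \<Union>L" by (auto simp: F_def)
  have "min_dominating {e\<in>E. e \<subseteq> V} F" unfolding min_dominating_def
  proof (intro conjI ballI)
    have "F \<subseteq> E" using L(1) x1 p1(3) c12 yz by (auto simp: F_def matching_def)
    then show "F \<subseteq> {e\<in>E. e \<subseteq> V}" using edges_V by blast
    fix e assume "e \<in> {e\<in>E. e \<subseteq> V}"
    then have e: "e \<in> E" "e \<subseteq> V" by auto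
    show "e \<inter> \<Union>F \<noteq> {}"
    proof (cases "e \<inter> {x, y, z} = {}")
      case True
      then have "e \<subseteq> C \<union> R" using e by auto
      then consider "e \<subseteq> C" | "e \<subseteq> R"
        using separated_C[OF subset_refl subset_refl] e(1) by (auto simp: separated_def)
      then show ?thesis
      proof cases
        case 1
        then have "e \<inter> \<Union>MC \<noteq> {}" using MC e by (simp add: max_matching_def)
        then show ?thesis unfolding UF UL by auto
      next
        case 2
        then have "e \<inter> \<Union>M \<noteq> {}" using M e by (simp add: max_matching_def)
        \<comment> \<open>\<open>F\<close> covers everything that \<open>M\<close> covers except
          \<open>x2\<close>. An edge of \<open>R\<close> at \<open>x2\<close> has a neighbour of
          \<open>y\<close> as its other end, and that one is covered.\<close>
        then have "e \<inter> \<Union>F \<noteq> {} \<or> x2 \<in> e" unfolding UF UL n2(3) by auto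
        moreover have ?thesis if x2e: "x2 \<in> e"
        proof -
          obtain w where w: "e = {x2, w}" using edge_at[OF e(1) x2e] by blast
          then have wR: "w \<in> R" and wE: "{x2, w} \<in> E" using 2 e by auto
          have "{y, w} \<in> E" by (rule nbr_of_nbr[OF x2 wR wE])
          then have "w \<in> \<Union>M" using R_covers[OF M wR] by simp
          moreover have "w \<noteq> x2" using edge_neq[OF wE] by simp
          ultimately have "w \<in> \<Union>F" unfolding UF UL n2(3) by auto
          then show ?thesis using w by auto
        qed
        ultimately show ?thesis by blast
      qed
    qed (auto simp: UF)
  next
    fix f assume "f \<in> F"
    then consider "f \<in> L" | "f = {x, x1}" | "f = {x1, y1}" | "f = {x1, y2}" | "f = {y, z}"
      by (auto simp: F_def)
    then show "\<exists>e\<in>{e\<in>E. e \<subseteq> V}. \<forall>g\<in>F. e \<inter> g \<noteq> {} \<longrightarrow> g = f"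
    proof cases
      case 1
      have "f \<in> E" using 1 L(1) by (auto simp: matching_def)
      moreover have "f \<inter> g = {}" if "g \<in> ?S" for g
        using far[of g f] 1 that by (auto simp: Int_commute)
      moreover have "g = f" if "g \<in> L" "f \<inter> g \<noteq> {}" for g
        using matching_disjoint[OF L(1) that(1) 1] that(2) by auto
      ultimately show ?thesis using edges_V by (intro bexI[of _ f]) (auto simp: F_def)
    next
      case 2
      show ?thesis
      proof (intro bexI[of _ "{x, x2}"] ballI impI)
        show "{x, x2} \<in> {e\<in>E. e \<subseteq> V}" using x2 edges_V by auto
        fix g assume "g \<in> F" "{x, x2} \<inter> g \<noteq> {}"
        then show "g = f" using far[of "{x, x2}" g] 2 neqs out distinct unfolding F_def by auto
      qed
    next
      case 3
      show ?thesis
      proof (intro bexI[of _ "{x2, y1}"] ballI impI)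
        show "{x2, y1} \<in> {e\<in>E. e \<subseteq> V}" using c21 edges_V by auto
        fix g assume "g \<in> F" "{x2, y1} \<inter> g \<noteq> {}"
        then show "g = f" using far[of "{x2, y1}" g] 3 neqs out distinct unfolding F_def by auto
      qed
    next
      case 4
      show ?thesis
      proof (intro bexI[of _ "{x2, y2}"] ballI impI)
        show "{x2, y2} \<in> {e\<in>E. e \<subseteq> V}" using p2(3) edges_V by auto
        fix g assume "g \<in> F" "{x2, y2} \<inter> g \<noteq> {}"
        then show "g = f" using far[of "{x2, y2}" g] 4 neqs out distinct unfolding F_def by auto
      qed
    next
      case 5
      show ?thesis
      proof (intro bexI[of _ "{y, z}"] ballI impI)
        show "{y, z} \<in> {e\<in>E. e \<subseteq> V}" using yz edges_V by auto
        fix g assume "g \<in> F" "{y, z} \<inter> g \<noteq> {}"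
        then show "g = f" using far[of "{y, z}" g] 5 neqs out distinct unfolding F_def by auto
      qed
    qed
  qed
  then have "card F = Suc n" using well_V by (simp add: well_def)
  moreover have "card ?S = 4" using neqs out distinct by (auto simp: doubleton_eq_iff)
  then have "card F = 4 + card L"
    unfolding F_def using disj matching_finite[OF L(1)] by (subst card_Un_disjoint) auto
  ultimately show False using L(2) n2(2) n1(2) cM ar(3) by simp
qed

text \<open>If one of \<open>x\<close>, \<open>y\<close> has a neighbour in \<open>U\<close>, so has
  the other by \<open>nbr_of_nbr_missed\<close>, and each has just one by \<open>unique_nbr\<close>.
  By \<open>nbr_of_nbr\<close>, a neighbour of \<open>x1\<close> in \<open>R\<close> is a neighbour
  of \<open>y\<close>, hence \<open>y1\<close>; the same holds with the roles exchanged.\<close>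

lemma house_or_isolated:
  obtains "\<And>v. v \<in> U \<Longrightarrow> {x, v} \<notin> E" "\<And>v. v \<in> U \<Longrightarrow> {y, v} \<notin> E"
  | x1 y1 where "x1 \<in> U" "y1 \<in> U" "{x, x1} \<in> E" "{y, y1} \<in> E" "{x1, y1} \<in> E"
    "\<And>v. v \<in> U \<Longrightarrow> {x, v} \<in> E \<Longrightarrow> v = x1" "\<And>v. v \<in> U \<Longrightarrow> {y, v} \<in> E \<Longrightarrow> v = y1"
    "\<And>v. {x1, v} \<in> E \<Longrightarrow> v = x \<or> v = y1" "\<And>v. {y1, v} \<in> E \<Longrightarrow> v = y \<or> v = x1"
proof -
  have RU: "v \<in> R" if "v \<in> U" "{s, v} \<in> E" "s \<in> {x, y}" for v s
    using that C_nbr[of v s] edge_sym[OF that(2)] notin_C distinct by auto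
  \<comment> \<open>A neighbour of \<open>v\<close> on the triangle other than \<open>s\<close>
    would form a second triangle with \<open>s\<close> and \<open>v\<close>.\<close>
  have closed: "w \<in> insert s R" if "v \<in> R" "{s, v} \<in> E" "{v, w} \<in> E" "s \<in> {x, y}" for v w s
  proof -
    have "w \<notin> C" using C_nbr[of w v] edge_sym[OF that(3)] that(1) by auto
    moreover have "w = s \<or> w \<notin> {x, y, z}"
    proof (rule ccontr)
      assume w: "\<not> ?thesis"
      then have "{s, w} \<in> E" using that(4) xy yz xz by (auto simp: insert_commute)
      then have "v \<in> {x, y, z}" using triangle[OF that(2,3)] by auto
      then show False using that(1) by auto
    qed
    ultimately show ?thesis using edge_V[OF that(3)] by auto
  qed
  show ?thesis
  proof (cases "\<exists>x1\<in>U. {x, x1} \<in> E")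
    case False
    have "{y, v} \<notin> E" if v: "v \<in> U" for v
    proof
      assume E: "{y, v} \<in> E"
      have vR: "v \<in> V - {y, x, z} - C" using RU[OF v E] by auto
      obtain N where N: "max_matching (V - {y, x, z} - C - {v}) N" by (rule max_matching_ex)
      obtain x' where "x' \<in> V - {y, x, z} - C" "{x, x'} \<in> E"
        using triangle_graph.nbr_of_nbr_missed[OF swap vR E N] by blast
      then show False using False by auto
    qed
    then show ?thesis using that(1) False by blast
  next
    case True
    then obtain x1 where x1: "x1 \<in> R" "{x, x1} \<in> E" using RU by blast
    obtain N where N: "max_matching (R - {x1}) N" by (rule max_matching_ex)
    obtain y1 where y1: "y1 \<in> R" "{y, y1} \<in> E" "{x1, y1} \<in> E"
      using nbr_of_nbr_missed[OF x1 N] by blast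
    have ux: "v = x1" if "v \<in> R" "{x, v} \<in> E" for v using unique_nbr[OF that x1] .
    have uy: "v = y1" if "v \<in> R" "{y, v} \<in> E" for v
      using triangle_graph.unique_nbr[OF swap, of v y1] that y1 by (simp add: swap_sets)
    show ?thesis
    proof (rule that(2))
      show "x1 \<in> U" "y1 \<in> U" "{x, x1} \<in> E" "{y, y1} \<in> E" "{x1, y1} \<in> E" using x1 y1 by auto
      show "v = x1" if "v \<in> U" "{x, v} \<in> E" for v using ux RU[OF that] that by simp
      show "v = y1" if "v \<in> U" "{y, v} \<in> E" for v using uy RU[OF that] that by simp
      show "v = x \<or> v = y1" if E: "{x1, v} \<in> E" for v
        using closed[OF x1 E] uy nbr_of_nbr[OF x1 _ E] by auto
      show "v = y \<or> v = x1" if E: "{y1, v} \<in> E" for v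
        using closed[OF y1(1,2) E] ux swap_nbr_of_nbr[OF y1(1,2) _ E] by auto
    qed
  qed
qed

text \<open>The equal sizes make \<open>z\<close> loose in \<open>W\<close>, which has no triangle
  as it avoids \<open>x\<close>. \<open>loose_bipartite\<close> might leave components uncoloured,
  but \<open>W\<close> meets the rest of the graph only through \<open>z\<close>, so
  \<open>A \<union> B \<union> (V - W)\<close> is closed under adjacency and connectedness makes it
  all of \<open>V\<close>.\<close>

lemma bipartite_part:
  assumes W: "W \<subseteq> V - {x, y}" "z \<in> W"
    and closed: "\<And>u v. \<lbrakk>u \<in> W; u \<noteq> z; {u, v} \<in> E\<rbrakk> \<Longrightarrow> v \<in> W"
    and well: "well W m" "well (W - {z}) m"
  obtains A B where "A \<union> B = W" "z \<in> B" "colouring W A B" "card A < card B"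
proof -
  have L: "loose W z m" using W well by (simp add: loose_def well_equimatchable)
  have fin: "finite W" using W finite_V by (meson finite_Diff finite_subset)
  have "{u, w} \<notin> E" if "u \<in> W" "v \<in> W" "w \<in> W" "{u, v} \<in> E" "{v, w} \<in> E" for u v w
  proof
    assume "{u, w} \<in> E"
    then have "x \<in> {u, v, w}" using triangle[OF that(4,5)] by simp
    then show False using that(1-3) W by auto
  qed
  then obtain A B where AB: "z \<in> B" "colouring W A B" "\<And>M. max_matching W M \<Longrightarrow> A \<subseteq> \<Union>M"
    using loose_bipartite[OF L fin] by metis
  have sub: "A \<union> B \<subseteq> W" using AB(2) by (simp add: colouring_def)
  have "A \<union> B \<union> (V - W) = V"
  proof (rule connected)
    fix u v assume uv: "u \<in> A \<union> B \<union> (V - W)" "{u, v} \<in> E"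
    have V: "u \<in> V" "v \<in> V" using edge_V[OF uv(2)] by auto
    show "v \<in> A \<union> B \<union> (V - W)"
    proof (cases "v \<in> W \<and> u \<in> W")
      case True
      then show ?thesis using colouring_edge[OF AB(2) uv(2)] uv(1) by auto
    next
      case False
      then have "v \<notin> W \<or> v = z" using closed[of v u] edge_sym[OF uv(2)] by auto
      then show ?thesis using V AB(1) by auto
    qed
  qed (use sub W AB(1) in auto)
  then have "A \<union> B = W" using sub W by auto
  then show ?thesis using that AB loose_card_less[OF L fin AB(1,2)] by blast
qed

text \<open>If every neighbour of \<open>c\<close> had another neighbour, the edges avoiding \<open>c\<close> would dominate
  \<open>W - z\<close>; as \<open>c\<close> stays uncovered, \<open>xy\<close>, \<open>xz\<close> and \<open>x x1\<close> can all be added.\<close>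

lemma pendant_nbr:
  assumes x1: "x1 \<in> U" "y1 \<in> U" "{x, x1} \<in> E" "{y, y1} \<in> E" "{x1, y1} \<in> E"
    and nbr: "\<And>v. {x1, v} \<in> E \<Longrightarrow> v = x \<or> v = y1" "\<And>v. {y1, v} \<in> E \<Longrightarrow> v = y \<or> v = x1"
    and W: "W = V - {x, y, z, x1, y1}" and well: "well W (n - 1)" and c: "c \<in> W" "{z, c} \<in> E"
  shows "\<exists>d\<in>W. {c, d} \<in> E \<and> (\<forall>v\<in>W. {d, v} \<in> E \<longrightarrow> v = c)"
proof (rule ccontr)
  assume no: "\<not> ?thesis"
  have other: "\<exists>v. v \<in> W \<and> {d, v} \<in> E \<and> v \<noteq> c" if "d \<in> W" "{c, d} \<in> E" for d
    using no that by blast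
  let ?D = "{e\<in>E. e \<subseteq> W}" and ?D' = "{e\<in>E. e \<subseteq> W - {c}}"
  have D': "?D' \<subseteq> ?D" "?D \<subseteq> E" by auto
  have dom: "e \<inter> \<Union>?D' \<noteq> {}" if e: "e \<in> ?D" for e
  proof (cases "c \<in> e")
    case True
    then obtain d where d: "e = {c, d}" using edge_at[of e c] e by blast
    then have dE: "{c, d} \<in> E" "d \<in> W" using e by auto
    then obtain v where "v \<in> W" "{d, v} \<in> E" "v \<noteq> c" using other by blast
    moreover have "d \<noteq> c" using edge_neq[OF dE(1)] by simp
    ultimately have "{d, v} \<in> ?D'" using dE by auto
    then have "d \<in> \<Union>?D'" by (rule UnionI) simp
    then show ?thesis using d by auto
  next
    case False
    then have "e \<in> ?D'" using e by auto
    then have "e \<subseteq> \<Union>?D'" by (rule Union_upper)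
    then show ?thesis using edge_nonempty[of e] e by (simp add: Int_absorb2)
  qed
  obtain F where F: "F \<subseteq> ?D'" "min_dominating ?D F"
    by (rule min_dominating_subset[OF D' dom])
  have subF: "\<Union>F \<subseteq> W - {c}" using F(1) by blast
  have un: "x \<notin> \<Union>F" "y \<notin> \<Union>F" "z \<notin> \<Union>F" "x1 \<notin> \<Union>F" "y1 \<notin> \<Union>F" "c \<notin> \<Union>F"
    using subF W by auto
  have neqs: "x1 \<noteq> y1" "x1 \<noteq> x" "x1 \<noteq> y" "x1 \<noteq> z" "y1 \<noteq> x" "y1 \<noteq> y" "y1 \<noteq> z"
    "c \<noteq> x" "c \<noteq> y" "c \<noteq> z" "c \<noteq> x1" "c \<noteq> y1"
    using x1(1,2) c(1) W edge_neq[OF x1(5)] by auto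
  have far: "e \<inter> g = {}" if "e \<subseteq> {x, y, z, x1, y1, c}" "g \<in> F" for e g
  proof -
    have "g \<subseteq> \<Union>F" using that(2) by (rule Union_upper)
    then show ?thesis using that(1) un by blast
  qed
  \<comment> \<open>The private edges are \<open>yy1\<close> for \<open>xy\<close>,
    \<open>zc\<close> for \<open>xz\<close> and \<open>x1y1\<close> for \<open>xx1\<close>; the
    second is available because \<open>F\<close> does not cover \<open>c\<close>. The total
    \<open>3 + (n - 1)\<close> exceeds \<open>Suc n\<close>.\<close>
  let ?S = "{{x, y}, {x, z}, {x, x1}}"
  have U': "\<Union>(?S \<union> F) = {x, y, z, x1} \<union> \<Union>F" by auto
  have "min_dominating {e\<in>E. e \<subseteq> V} (?S \<union> F)" unfolding min_dominating_def
  proof (intro conjI ballI)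
    have "?S \<union> F \<subseteq> E" using F(1) xy xz x1 by auto
    then show "?S \<union> F \<subseteq> {e\<in>E. e \<subseteq> V}" using edges_V by blast
    fix e assume "e \<in> {e\<in>E. e \<subseteq> V}"
    then have e: "e \<in> E" "e \<subseteq> V" by auto
    show "e \<inter> \<Union>(?S \<union> F) \<noteq> {}"
    proof (cases "e \<inter> {x, y, z, x1} = {}")
      case True
      have "y1 \<notin> e"
      proof
        assume "y1 \<in> e"
        then obtain w where w: "e = {y1, w}" using edge_at e(1) by blast
        then have "w = y \<or> w = x1" using nbr(2) e(1) by simp
        then show False using w True by auto
      qed
      then have "e \<in> ?D" using True e W by auto
      then have "e \<inter> \<Union>F \<noteq> {}" using F(2) by (simp add: min_dominating_def)
      then show ?thesis unfolding U' by auto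
    qed (auto simp: U')
  next
    fix f assume "f \<in> ?S \<union> F"
    then consider "f \<in> F" | "f = {x, y}" | "f = {x, z}" | "f = {x, x1}" by auto
    then show "\<exists>e\<in>{e\<in>E. e \<subseteq> V}. \<forall>g\<in>?S \<union> F. e \<inter> g \<noteq> {} \<longrightarrow> g = f"
    proof cases
      case 1
      obtain e where e: "e \<in> ?D" "\<forall>g\<in>F. e \<inter> g \<noteq> {} \<longrightarrow> g = f"
        by (rule min_dominating_private[OF F(2) 1])
      have "e \<inter> g = {}" if "g \<in> ?S" for g using that e(1) W by auto
      then show ?thesis using e edges_V by (intro bexI[of _ e]) auto
    next
      case 2
      show ?thesis
      proof (intro bexI[of _ "{y, y1}"] ballI impI)
        show "{y, y1} \<in> {e\<in>E. e \<subseteq> V}" using x1 edges_V by auto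
        fix g assume "g \<in> ?S \<union> F" "{y, y1} \<inter> g \<noteq> {}"
        then show "g = f" using far[of "{y, y1}" g] 2 neqs distinct by auto
      qed
    next
      case 3
      show ?thesis
      proof (intro bexI[of _ "{z, c}"] ballI impI)
        show "{z, c} \<in> {e\<in>E. e \<subseteq> V}" using c edges_V by auto
        fix g assume "g \<in> ?S \<union> F" "{z, c} \<inter> g \<noteq> {}"
        then show "g = f" using far[of "{z, c}" g] 3 neqs distinct by auto
      qed
    next
      case 4
      show ?thesis
      proof (intro bexI[of _ "{x1, y1}"] ballI impI)
        show "{x1, y1} \<in> {e\<in>E. e \<subseteq> V}" using x1 edges_V by auto
        fix g assume "g \<in> ?S \<union> F" "{x1, y1} \<inter> g \<noteq> {}"
        then show "g = f" using far[of "{x1, y1}" g] 4 neqs distinct by auto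
      qed
    qed
  qed
  then have "card (?S \<union> F) = Suc n" using well_V by (simp add: well_def)
  moreover have "card (?S \<union> F) = card ?S + card F"
  proof (rule card_Un_disjoint)
    show "finite F" using F(1) finite_E by (auto intro: finite_subset)
    show "?S \<inter> F = {}" using far[of "{x, y}" "{x, y}"] far[of "{x, z}" "{x, z}"]
        far[of "{x, x1}" "{x, x1}"] by auto
  qed simp
  moreover have "card ?S = 3" using neqs distinct by (auto simp: doubleton_eq_iff)
  ultimately have "3 + card F = Suc n" by linarith
  moreover have "card F = n - 1" using F(2) well by (simp add: well_def)
  ultimately show False by simp
qed

end

section \<open>Translation to graphs and gluing\<close>

lemma Int_Union_nonempty_iff: "e \<inter> \<Union>F \<noteq> {} \<longleftrightarrow> (\<exists>f\<in>F. e \<inter> f \<noteq> {})"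
  by blast

text \<open>Edges are nonempty, so a member of \<open>F\<close> meets itself and domination just
  means meeting \<open>\<Union>F\<close>. Dropping \<open>f\<close> leaves an edge undominated
  exactly when that edge is private to \<open>f\<close>.\<close>

lemma (in edge_set) minimal_edge_dominating_iff:
  assumes "edges H \<subseteq> E"
  shows "minimal_edge_dominating H F \<longleftrightarrow> min_dominating (edges H) F"
proof -
  have dom: "edge_dominating H F \<longleftrightarrow> F \<subseteq> edges H \<and> (\<forall>e\<in>edges H. e \<inter> \<Union>F \<noteq> {})" for F
  proof -
    have "(e \<in> F \<or> (\<exists>f\<in>F. e \<inter> f \<noteq> {})) \<longleftrightarrow> e \<inter> \<Union>F \<noteq> {}" if e: "e \<in> edges H" for e
    proof -
      have "e \<noteq> {}" using edge_nonempty e assms by blast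
      then have "(e \<in> F \<or> (\<exists>f\<in>F. e \<inter> f \<noteq> {})) \<longleftrightarrow> (\<exists>f\<in>F. e \<inter> f \<noteq> {})"
        by (metis Int_absorb)
      also have "\<dots> \<longleftrightarrow> e \<inter> \<Union>F \<noteq> {}" by (rule Int_Union_nonempty_iff[symmetric])
      finally show ?thesis .
    qed
    then show ?thesis by (simp add: edge_dominating_def)
  qed
  show ?thesis
  proof
    assume L: "minimal_edge_dominating H F"
    then have F: "F \<subseteq> edges H" "\<forall>e\<in>edges H. e \<inter> \<Union>F \<noteq> {}"
      by (auto simp: minimal_edge_dominating_def dom)
    have "\<exists>e\<in>edges H. \<forall>g\<in>F. e \<inter> g \<noteq> {} \<longrightarrow> g = f" if f: "f \<in> F" for f
    proof -
      have "F - {f} \<subset> F" using f by auto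
      then have "\<not> edge_dominating H (F - {f})" using L by (simp add: minimal_edge_dominating_def)
      moreover have "F - {f} \<subseteq> edges H" using F(1) by auto
      ultimately obtain e where e: "e \<in> edges H" "e \<inter> \<Union>(F - {f}) = {}" using dom by auto
      have "g = f" if "g \<in> F" "e \<inter> g \<noteq> {}" for g
      proof (rule ccontr)
        assume "g \<noteq> f"
        then have "e \<inter> \<Union>(F - {f}) \<noteq> {}" unfolding Int_Union_nonempty_iff
          using that by (intro bexI[of _ g]) simp_all
        then show False using e(2) by simp
      qed
      then show ?thesis using e(1) by blast
    qed
    then show "min_dominating (edges H) F" using F by (simp add: min_dominating_def)
  next
    assume R: "min_dominating (edges H) F"
    have "\<not> edge_dominating H F'" if sub: "F' \<subset> F" for F'
    proof
      assume D: "edge_dominating H F'"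
      obtain f where f: "f \<in> F" "f \<notin> F'" using sub by auto
      obtain e where e: "e \<in> edges H" "\<forall>g\<in>F. e \<inter> g \<noteq> {} \<longrightarrow> g = f"
        by (rule min_dominating_private[OF R f(1)])
      have "e \<inter> \<Union>F' \<noteq> {}" using D e(1) by (simp add: dom)
      then obtain g where g: "g \<in> F'" "e \<inter> g \<noteq> {}" unfolding Int_Union_nonempty_iff by metis
      then have "g \<in> F" using sub by auto
      then have "g = f" using e(2) g(2) by simp
      then show False using g(1) f by simp
    qed
    moreover have "edge_dominating H F" using R by (simp add: dom min_dominating_def)
    ultimately show "minimal_edge_dominating H F" by (simp add: minimal_edge_dominating_def)
  qed
qed

lemma (in edge_set) well_edge_dominatedI:
  assumes "well S n" "edges H = {e\<in>E. e \<subseteq> S}"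
  shows "well_edge_dominated H"
proof -
  have "edges H \<subseteq> E" using assms(2) by auto
  then show ?thesis using assms
    by (simp add: well_edge_dominated_def minimal_edge_dominating_iff well_def)
qed

lemma (in edge_set) well_edge_dominatedD:
  assumes "well_edge_dominated H" "edges H = {e\<in>E. e \<subseteq> S}"
  obtains n where "well S n"
proof -
  have sub: "edges H \<subseteq> E" using assms(2) by auto
  obtain M where "max_matching S M" by (rule max_matching_ex)
  then have "min_dominating (edges H) M" using max_matching_min_dominating assms(2) by simp
  then have M: "minimal_edge_dominating H M" using minimal_edge_dominating_iff[OF sub] by simp
  have "card F = card M" if "min_dominating {e\<in>E. e \<subseteq> S} F" for F
  proof -
    have "minimal_edge_dominating H F"
      using minimal_edge_dominating_iff[OF sub] that assms(2) by simp
    then show ?thesis using M assms(1) unfolding well_edge_dominated_def by metis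
  qed
  then have "well S (card M)" by (simp add: well_def)
  then show ?thesis by (rule that)
qed

section \<open>Isomorphisms and gluing\<close>

lemma edges_induced_subgraph: "edges (induced_subgraph G S) = {e\<in>edges G. e \<subseteq> S}"
  and verts_induced_subgraph: "verts (induced_subgraph G S) = verts G \<inter> S"
  by (simp_all add: induced_subgraph_def)

lemma isomorphic_image:
  assumes G: "simple_graph G" and inj: "inj_on f (verts G)"
    and "verts H = f ` verts G" "edges H = image f ` edges G"
  shows "isomorphic G H"
  unfolding isomorphic_def
proof (intro exI conjI ballI)
  show "bij_betw f (verts G) (verts H)" using inj assms(3) by (simp add: bij_betw_def)
  fix u v assume uv: "u \<in> verts G" "v \<in> verts G"
  have "{f u, f v} \<in> edges H \<longleftrightarrow> f ` {u, v} \<in> image f ` edges G" using assms(4) by simp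
  also have "\<dots> \<longleftrightarrow> {u, v} \<in> edges G"
  proof
    assume "f ` {u, v} \<in> image f ` edges G"
    then obtain e where e: "e \<in> edges G" "f ` {u, v} = f ` e" by blast
    moreover have "e \<subseteq> verts G" using e(1) G by (simp add: simple_graph_def)
    ultimately have "{u, v} = e" using inj uv by (subst (asm) inj_on_image_eq_iff) auto
    then show "{u, v} \<in> edges G" using e by simp
  qed (rule imageI)
  finally show "adj G u v \<longleftrightarrow> adj H (f u) (f v)" by (simp add: adj_def)
qed

text \<open>Recognises \<open>G\<close> as a glued graph: \<open>h\<close> places a copy of
  \<open>K\<close> in \<open>G\<close> that meets \<open>G'\<close> only in \<open>w\<close>, the
  image of \<open>p\<close>.\<close>

lemma isomorphic_glue:
  fixes K :: "nat graph" and G G' :: "'a graph"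
  assumes G: "simple_graph G" and K: "\<And>e. e \<in> edges K \<Longrightarrow> e \<subseteq> verts K"
    and p: "p \<in> verts K" "h p = w" and w: "w \<in> verts G'" and inj: "inj_on h (verts K)"
    and G': "\<And>e. e \<in> edges G' \<Longrightarrow> e \<subseteq> verts G'"
    and int: "h ` verts K \<inter> verts G' \<subseteq> {w}"
    and V: "verts G = h ` verts K \<union> verts G'"
    and E: "edges G = image h ` edges K \<union> edges G'"
  shows "isomorphic G (identify (Inl p) (Inr w) (disjoint_union K G'))"
proof -
  \<comment> \<open>\<open>f\<close> sends the shared vertex to the right summand, in agreement with
    the renaming \<open>q\<close> done by \<open>identify\<close>, which moves \<open>Inl p\<close>
    to \<open>Inr w\<close>.\<close>
  define f where "f v = (if v \<in> verts G' then Inr v else Inl (inv_into (verts K) h v))" for v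
  define q where "q = (id(Inl p := Inr w) :: nat + 'a \<Rightarrow> nat + 'a)"
  have fh: "f (h k) = q (Inl k)" if k: "k \<in> verts K" for k
  proof (cases "h k \<in> verts G'")
    case True
    then have "h k = h p" using int k p by auto
    then have "k = p" using inj k p(1) by (simp add: inj_on_def)
    then show ?thesis using True p by (simp add: f_def q_def)
  next
    case False
    then have "k \<noteq> p" using p w by auto
    then show ?thesis using False k inj by (simp add: f_def q_def)
  qed
  have fG: "f v = q (Inr v)" if "v \<in> verts G'" for v using that by (simp add: f_def q_def)
  have imK: "f ` h ` e = q ` Inl ` e" if "e \<subseteq> verts K" for e
    unfolding image_image using fh that by (intro image_cong) auto
  have imG: "f ` e = q ` Inr ` e" if "e \<subseteq> verts G'" for e
    unfolding image_image using fG that by (intro image_cong) auto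
  show ?thesis
  proof (rule isomorphic_image[OF G])
    show "inj_on f (verts G)"
    proof (rule inj_onI)
      fix u v assume uv: "u \<in> verts G" "v \<in> verts G" "f u = f v"
      then have "u \<in> verts G' \<longleftrightarrow> v \<in> verts G'" by (auto simp: f_def split: if_splits)
      then show "u = v" using uv V inv_into_injective[of "verts K" h u v]
        by (auto simp: f_def split: if_splits)
    qed
    show "verts (identify (Inl p) (Inr w) (disjoint_union K G')) = f ` verts G"
      unfolding identify_def disjoint_union_def V image_Un Plus_def q_def[symmetric]
      using imK[OF subset_refl] imG[OF subset_refl] by (simp add: image_Un)
    have "image q ` image Inl ` edges K = (\<lambda>e. q ` Inl ` e) ` edges K" by (rule image_image)
    also have "\<dots> = (\<lambda>e. f ` h ` e) ` edges K" by (rule image_cong) (use imK K in simp_all)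
    also have "\<dots> = image f ` image h ` edges K" by (rule image_image[symmetric])
    finally have *: "image q ` image Inl ` edges K = image f ` image h ` edges K" .
    have "image q ` image Inr ` edges G' = (\<lambda>e. q ` Inr ` e) ` edges G'" by (rule image_image)
    also have "\<dots> = image f ` edges G'" by (rule image_cong) (use imG G' in simp_all)
    finally have "image q ` image Inr ` edges G' = image f ` edges G'" .
    with * show "edges (identify (Inl p) (Inr w) (disjoint_union K G')) = image f ` edges G"
      unfolding identify_def disjoint_union_def E q_def[symmetric] by (simp add: image_Un)
  qed
qed

section \<open>From the given graph to the locale\<close>

lemma K3_isomorphic:
  assumes iso: "isomorphic T K3" and T: "simple_graph T" and V: "verts T = {x, y, z}"
  shows "{x, y} \<in> edges T" "{y, z} \<in> edges T" "{x, z} \<in> edges T"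
proof -
  obtain f where f: "bij_betw f (verts T) (verts K3)"
    "\<forall>u\<in>verts T. \<forall>v\<in>verts T. adj T u v \<longleftrightarrow> adj K3 (f u) (f v)"
    using iso by (auto simp: isomorphic_def)
  \<comment> \<open>The bijection with \<open>K3\<close> forces \<open>x\<close>, \<open>y\<close>,
    \<open>z\<close> to be distinct.\<close>
  have "card {x, y, z} = 3" using bij_betw_same_card[OF f(1)] V by (simp add: K3_def)
  then have d: "x \<noteq> y" "y \<noteq> z" "x \<noteq> z" by (auto simp: card_insert_if split: if_splits)
  have K3: "adj K3 a b" if "a \<in> verts K3" "b \<in> verts K3" "a \<noteq> b" for a b
    using that by (auto simp: K3_def adj_def insert_commute)
  have adj: "{u, v} \<in> edges T" if "u \<in> verts T" "v \<in> verts T" "u \<noteq> v" for u v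
  proof -
    have "f u \<noteq> f v" using f(1) that by (auto simp: bij_betw_def inj_on_def)
    moreover have "f u \<in> verts K3" "f v \<in> verts K3" using f(1) that by (auto simp: bij_betw_def)
    ultimately have "adj K3 (f u) (f v)" by (intro K3)
    then show ?thesis using f(2) that by (simp add: adj_def)
  qed
  show "{x, y} \<in> edges T" "{y, z} \<in> edges T" "{x, z} \<in> edges T"
    using adj d V by simp_all
qed

text \<open>Turns three pairwise adjacent vertices into a subgraph, to which uniqueness of the
  triangle applies.\<close>

lemma triangle_of_edges:
  assumes G: "simple_graph G" and uvw: "{u, v} \<in> edges G" "{v, w} \<in> edges G" "{u, w} \<in> edges G"
  shows "triangle \<lparr>verts = {u, v, w}, edges = {{u, v}, {v, w}, {u, w}}\<rparr> G"
proof -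
  have e: "e \<subseteq> verts G" "card e = 2" if "e \<in> edges G" for e
    using that G by (auto simp: simple_graph_def)
  have d: "u \<noteq> v" "v \<noteq> w" "u \<noteq> w" using e(2)[OF uvw(1)] e(2)[OF uvw(2)] e(2)[OF uvw(3)] by auto
  let ?T = "\<lparr>verts = {u, v, w}, edges = {{u, v}, {v, w}, {u, w}}\<rparr>"
  have T: "simple_graph ?T" using d by (auto simp: simple_graph_def)
  define f where "f = (\<lambda>t. if t = u then 1 else if t = v then 2 else 3 :: nat)"
  have "isomorphic ?T K3"
    by (rule isomorphic_image[OF T, of f]) (use d in \<open>auto simp: f_def K3_def inj_on_def\<close>)
  then show ?thesis using T e(1)[OF uvw(1)] e(1)[OF uvw(2)] uvw by (auto simp: triangle_def subgraph_def)
qed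

text \<open>Otherwise adjoining \<open>v\<close> and the edge \<open>uv\<close> would give a larger
  connected subgraph, against the maximality of \<open>C\<close>.\<close>

lemma component_closed:
  assumes C: "component C H" and H: "simple_graph H" and uv: "u \<in> verts C" "{u, v} \<in> edges H"
  shows "v \<in> verts C"
proof (rule ccontr)
  assume v: "v \<notin> verts C"
  have sub: "subgraph C H" and conn: "connected C"
    and max: "\<And>D. subgraph D H \<Longrightarrow> connected D \<Longrightarrow> subgraph C D \<Longrightarrow> D = C"
    using C by (auto simp: component_def)
  let ?D = "\<lparr>verts = insert v (verts C), edges = insert {u, v} (edges C)\<rparr>"
  have vH: "v \<in> verts H" "card {u, v} = 2" using uv H by (auto simp: simple_graph_def)
  have sD: "simple_graph ?D" using sub vH uv by (auto simp: simple_graph_def subgraph_def)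
  have DH: "subgraph ?D H" using sD sub vH uv by (auto simp: subgraph_def)
  have CD: "subgraph C ?D" using sub by (auto simp: subgraph_def)
  let ?r = "{(a, b). adj ?D a b}"
  have "{(a, b). adj C a b} \<subseteq> ?r" by (auto simp: adj_def)
  then have sub_r: "{(a, b). adj C a b}\<^sup>* \<subseteq> ?r\<^sup>*" by (rule rtrancl_mono)
  have "sym ?r" by (auto simp: sym_def adj_def insert_commute)
  then have sym: "(a, b) \<in> ?r\<^sup>* \<Longrightarrow> (b, a) \<in> ?r\<^sup>*" for a b by (meson symD sym_rtrancl)
  have uv': "(u, v) \<in> ?r\<^sup>*" by (auto simp: adj_def)
  have to_u: "(a, u) \<in> ?r\<^sup>*" if "a \<in> insert v (verts C)" for a
  proof (cases "a = v")
    case True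
    then show ?thesis using sym[OF uv'] by simp
  next
    case False
    then have "(a, u) \<in> {(a, b). adj C a b}\<^sup>*" using that conn uv by (simp add: connected_def)
    then show ?thesis using sub_r by blast
  qed
  have "connected ?D" unfolding connected_def
  proof (intro conjI ballI)
    fix a b assume "a \<in> verts ?D" "b \<in> verts ?D"
    then show "(a, b) \<in> ?r\<^sup>*" using to_u[of a] sym[OF to_u[of b]] by (auto intro: rtrancl_trans)
  qed simp
  then have "?D = C" using max DH CD by blast
  then have "verts C = insert v (verts C)" by (metis graph.select_convs(1))
  then show False using v by auto
qed

lemma connected_closed_set:
  assumes conn: "connected G" and K: "K \<noteq> {}" "K \<subseteq> verts G"
    and closed: "\<And>u v. \<lbrakk>u \<in> K; {u, v} \<in> edges G\<rbrakk> \<Longrightarrow> v \<in> K"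
  shows "K = verts G"
proof -
  obtain k where k: "k \<in> K" using K by auto
  have "v \<in> K" if "v \<in> verts G" for v
  proof -
    have "(k, v) \<in> {(a, b). adj G a b}\<^sup>*" using conn k K that by (auto simp: connected_def)
    then show ?thesis
      by (induction rule: rtrancl_induct) (use k closed in \<open>auto simp: adj_def\<close>)
  qed
  then show ?thesis using K by auto
qed

lemma triangle_graph_of_graph:
  fixes G T :: "'a graph"
  assumes G: "simple_graph G" and conn: "connected G" and wed: "well_edge_dominated G"
    and T: "{H. triangle H G} = {T}" "verts T = {x, y, z}"
    and C: "component C (induced_subgraph G (verts G - {x, y, z}))"
      "\<forall>v\<in>verts C. \<not> adj G v x \<and> \<not> adj G v y"
  obtains n where "triangle_graph (edges G) (verts G) (verts C) x y z n"
proof -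
  have eV: "e \<subseteq> verts G" if "e \<in> edges G" for e using that G by (simp add: simple_graph_def)
  have fin: "finite (verts G)" using G by (simp add: simple_graph_def)
  interpret edge_set "edges G"
  proof
    show "finite (edges G)" by (rule finite_subset[of _ "Pow (verts G)"]) (use eV fin in auto)
  qed (use G in \<open>simp add: simple_graph_def\<close>)
  have tT: "triangle T G" using T by auto
  then have "subgraph T G" "isomorphic T K3" by (auto simp: triangle_def)
  then have xyz: "{x, y} \<in> edges G" "{y, z} \<in> edges G" "{x, z} \<in> edges G"
    using K3_isomorphic[of T x y z] T(2) by (auto simp: subgraph_def)
  have "edges G = {e\<in>edges G. e \<subseteq> verts G}" using eV by auto
  from well_edge_dominatedD[OF wed this] obtain m where m: "well (verts G) m" .
  \<comment> \<open>The edge \<open>xy\<close> makes the common size positive, so it has the form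
    \<open>Suc n\<close>.\<close>
  have "m \<ge> 1" using equimatchable_remove(2)[OF well_equimatchable[OF m] xyz(1)] eV[OF xyz(1)] by auto
  then obtain n where n: "m = Suc n" by (cases m) auto
  let ?H = "induced_subgraph G (verts G - {x, y, z})"
  have H: "simple_graph ?H" using G by (auto simp: simple_graph_def induced_subgraph_def)
  have CH: "verts C \<subseteq> verts ?H" "verts C \<noteq> {}" using C(1) by (auto simp: component_def subgraph_def connected_def)
  have "triangle_graph (edges G) (verts G) (verts C) x y z n"
  proof
    show "{u, v, w} = {x, y, z}"
      if "{u, v} \<in> edges G" "{v, w} \<in> edges G" "{u, w} \<in> edges G" for u v w
    proof -
      have "\<lparr>verts = {u, v, w}, edges = {{u, v}, {v, w}, {u, w}}\<rparr> \<in> {H. triangle H G}"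
        using triangle_of_edges[OF G that] by simp
      then have "\<lparr>verts = {u, v, w}, edges = {{u, v}, {v, w}, {u, w}}\<rparr> = T" using T(1) by simp
      then show ?thesis using T(2) by (metis graph.select_convs(1))
    qed
    show "well (verts G) (Suc n)" using m n by simp
    show "K = verts G" if "K \<noteq> {}" "K \<subseteq> verts G" "\<And>u v. \<lbrakk>u \<in> K; {u, v} \<in> edges G\<rbrakk> \<Longrightarrow> v \<in> K" for K
      by (rule connected_closed_set[OF conn that])
    show "verts C \<subseteq> verts G - {x, y, z}" using CH by (auto simp: verts_induced_subgraph)
    show "v \<in> insert z (verts C)" if uv: "u \<in> verts C" "{u, v} \<in> edges G" for u v
    proof (cases "v = z")
      case False
      have "v \<noteq> x" "v \<noteq> y" using C(2) uv by (auto simp: adj_def)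
      then have "{u, v} \<in> edges ?H" using uv False CH eV[OF uv(2)]
        by (auto simp: edges_induced_subgraph verts_induced_subgraph)
      then show ?thesis using component_closed[OF C(1) H uv(1)] by simp
    qed simp
  qed (use fin eV xyz CH in auto)
  then show ?thesis by (rule that)
qed

section \<open>Membership in the two families\<close>

context triangle_graph
begin

text \<open>The graph induced on \<open>W\<close> plays the part of \<open>G'\<close>, with
  \<open>z\<close> as the vertex of attachment; equal sizes on \<open>W\<close> and
  \<open>W - {z}\<close> give both the bipartition and detachability.\<close>

lemma wed_bipartite_induced:
  assumes G: "simple_graph G" "verts G = V" "edges G = E"
    and W: "W \<subseteq> V - {x, y}" "z \<in> W"
    and closed: "\<And>u v. \<lbrakk>u \<in> W; u \<noteq> z; {u, v} \<in> E\<rbrakk> \<Longrightarrow> v \<in> W"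
    and well: "well W m" "well (W - {z}) m"
  obtains A B where "wed_bipartite (induced_subgraph G W) A B" "detachable (induced_subgraph G W) B z"
proof -
  let ?H = "induced_subgraph G W"
  have vH: "verts ?H = W" and eH: "edges ?H = {e\<in>E. e \<subseteq> W}"
    using G W by (auto simp: verts_induced_subgraph edges_induced_subgraph)
  obtain A B where AB: "A \<union> B = W" "z \<in> B" "colouring W A B" "card A < card B"
    by (rule bipartite_part[OF W closed well])
  have "bipartition ?H A B" unfolding bipartition_def vH eH
  proof (intro conjI ballI)
    show "A \<inter> B = {}" using AB(3) by (simp add: colouring_def)
    fix e assume "e \<in> {e\<in>E. e \<subseteq> W}"
    then have e: "e \<in> E" "e \<subseteq> W" by auto
    then obtain u v where uv: "e = {u, v}" by (metis edge_cases)
    then show "\<exists>a\<in>A. \<exists>b\<in>B. e = {a, b}"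
      using colouring_edge[OF AB(3), of u v] e AB(1) by (auto simp: insert_commute)
  qed (use AB in simp)
  moreover have "simple_graph ?H" using G(1) by (auto simp: simple_graph_def induced_subgraph_def)
  moreover have "well_edge_dominated ?H" by (rule well_edge_dominatedI[OF well(1) eH])
  ultimately have "wed_bipartite ?H A B" using AB(4) by (simp add: wed_bipartite_def)
  moreover have "edges (del_vertex ?H z) = {e\<in>E. e \<subseteq> W - {z}}"
    using G(3) by (auto simp: del_vertex_def edges_induced_subgraph vH)
  then have "well_edge_dominated (del_vertex ?H z)" by (rule well_edge_dominatedI[OF well(2)])
  then have "detachable ?H B z" using AB(2) by (simp add: detachable_def)
  ultimately show ?thesis by (rule that)
qed

text \<open>Deleting \<open>x\<close> and \<open>y\<close> leaves \<open>W\<close>; deleting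
  \<open>x\<close> and \<open>z\<close> leaves \<open>W - {z}\<close> together with
  \<open>y\<close>, now isolated. Both need \<open>n\<close> edges.\<close>

lemma in_family_T:
  assumes G: "simple_graph G" "verts G = V" "edges G = E"
    and no: "\<And>v. v \<in> U \<Longrightarrow> {x, v} \<notin> E" "\<And>v. v \<in> U \<Longrightarrow> {y, v} \<notin> E"
  shows "G \<in> family_T"
proof -
  define W where "W = V - {x, y}"
  have nbr: "v \<in> {x, y, z}" if "{s, v} \<in> E" "s \<in> {x, y}" for s v
    using that no edge_V[OF that(1)] by auto
  have closed: "v \<in> W" if "u \<in> W" "u \<noteq> z" "{u, v} \<in> E" for u v
    using that nbr[of v u] edge_V[OF that(3)] edge_sym[OF that(3)] by (auto simp: W_def)
  have "well (V - {x, z}) n" using well_remove[OF well_V xz] xyz_V by simp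
  moreover have "{e\<in>E. e \<subseteq> V - {x, z}} = {e\<in>E. e \<subseteq> W - {z}}"
  proof -
    have "y \<notin> e" if e: "e \<in> E" "e \<subseteq> V - {x, z}" for e
    proof
      assume "y \<in> e"
      then obtain w where "e = {y, w}" using edge_at[OF e(1)] by blast
      then show False using nbr[of y w] edge_neq[of y w] e by auto
    qed
    then show ?thesis by (auto simp: W_def)
  qed
  ultimately have well2: "well (W - {z}) n" by (simp add: well_def)
  have well1: "well W n" using well_remove[OF well_V xy] xyz_V by (simp add: W_def)
  have W: "W \<subseteq> V - {x, y}" "z \<in> W" using xyz_V distinct by (auto simp: W_def)
  obtain A B where AB: "wed_bipartite (induced_subgraph G W) A B" "detachable (induced_subgraph G W) B z"
    by (rule wed_bipartite_induced[OF G W closed well1 well2])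
  define h where "h k = (if k = (1::nat) then z else if k = 2 then x else y)" for k
  have "isomorphic G (identify (Inl 1) (Inr z) (disjoint_union K3 (induced_subgraph G W)))"
  proof (rule isomorphic_glue[where h = h])
    show "edges G = image h ` edges K3 \<union> edges (induced_subgraph G W)"
    proof -
      have "e \<in> {{x, y}, {x, z}, {y, z}}" if e: "e \<in> E" "\<not> e \<subseteq> W" for e
      proof -
        obtain s where s: "s \<in> e" "s \<in> {x, y}" using e edges_V by (auto simp: W_def)
        then obtain w where w: "e = {s, w}" using edge_at[OF e(1)] by blast
        then show ?thesis using nbr[of s w] s edge_neq[of s w] e by (auto simp: insert_commute)
      qed
      moreover have "image h ` edges K3 = {{x, y}, {x, z}, {y, z}}"
        by (auto simp: h_def K3_def insert_commute)
      ultimately show ?thesis using xy xz yz by (auto simp: edges_induced_subgraph G)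
    qed
  qed (use G W xyz_V distinct in \<open>auto simp: h_def K3_def inj_on_def verts_induced_subgraph
      edges_induced_subgraph W_def\<close>)
  moreover have "1 \<in> verts K3" by (simp add: K3_def)
  ultimately show ?thesis using G(1) AB unfolding family_T_def by blast
qed

text \<open>Deleting the ends of \<open>xx1\<close> and \<open>yy1\<close> leaves \<open>W\<close>;
  deleting those of \<open>xz\<close> and \<open>yy1\<close> leaves \<open>W - {z}\<close> together
  with \<open>x1\<close>, now isolated. Both need \<open>n - 1\<close> edges, and
  \<open>pendant_nbr\<close> makes \<open>z\<close> strongly detachable.\<close>

lemma in_family_F:
  assumes G: "simple_graph G" "verts G = V" "edges G = E"
    and x1: "x1 \<in> U" "y1 \<in> U" "{x, x1} \<in> E" "{y, y1} \<in> E" "{x1, y1} \<in> E"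
    and nx: "\<And>v. v \<in> U \<Longrightarrow> {x, v} \<in> E \<Longrightarrow> v = x1" and ny: "\<And>v. v \<in> U \<Longrightarrow> {y, v} \<in> E \<Longrightarrow> v = y1"
    and nx1: "\<And>v. {x1, v} \<in> E \<Longrightarrow> v = x \<or> v = y1" and ny1: "\<And>v. {y1, v} \<in> E \<Longrightarrow> v = y \<or> v = x1"
  shows "G \<in> family_F"
proof -
  define W where "W = V - {x, y, x1, y1}"
  have neqs: "x1 \<noteq> y1" "x1 \<noteq> x" "x1 \<noteq> y" "x1 \<noteq> z" "y1 \<noteq> x" "y1 \<noteq> y" "y1 \<noteq> z"
    using x1(1,2) edge_neq[OF x1(5)] by auto
  have Vs: "x1 \<in> V" "y1 \<in> V" using x1 by auto
  have nx': "v \<in> {y, z, x1}" if "{x, v} \<in> E" for v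
    using that nx[of v] edge_V[OF that] edge_neq[OF that] by auto
  have ny': "v \<in> {x, z, y1}" if "{y, v} \<in> E" for v
    using that ny[of v] edge_V[OF that] edge_neq[OF that] by auto
  have closed: "v \<in> W" if "u \<in> W" "u \<noteq> z" "{u, v} \<in> E" for u v
    using that nx'[of u] ny'[of u] nx1[of u] ny1[of u] edge_V[OF that(3)] edge_sym[OF that(3)]
    by (auto simp: W_def)
  have "well (V - {x, x1} - {y, y1}) (n - 1)"
    using well_remove[OF well_remove[OF well_V x1(3)] x1(4)] xyz_V Vs neqs distinct by simp
  moreover have "V - {x, x1} - {y, y1} = W" by (auto simp: W_def)
  ultimately have well1: "well W (n - 1)" by simp
  have "well (V - {x, z} - {y, y1}) (n - 1)"
    using well_remove[OF well_remove[OF well_V xz] x1(4)] xyz_V Vs neqs distinct by simp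
  moreover have "{e\<in>E. e \<subseteq> V - {x, z} - {y, y1}} = {e\<in>E. e \<subseteq> W - {z}}"
  proof -
    have "x1 \<notin> e" if e: "e \<in> E" "e \<subseteq> V - {x, z} - {y, y1}" for e
    proof
      assume "x1 \<in> e"
      then obtain w where "e = {x1, w}" using edge_at[OF e(1)] by blast
      then show False using nx1[of w] e by auto
    qed
    then show ?thesis by (auto simp: W_def)
  qed
  ultimately have well2: "well (W - {z}) (n - 1)" by (simp add: well_def)
  have W: "W \<subseteq> V - {x, y}" "z \<in> W" using xyz_V distinct neqs by (auto simp: W_def)
  let ?H = "induced_subgraph G W"
  obtain A B where AB: "wed_bipartite ?H A B" "detachable ?H B z"
    by (rule wed_bipartite_induced[OF G W closed well1 well2])
  have Wz: "W - {z} = V - {x, y, z, x1, y1}" by (auto simp: W_def)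
  have vD: "verts (del_vertex ?H z) = W - {z}" and eD: "edges (del_vertex ?H z) = {e\<in>E. e \<subseteq> W - {z}}"
    using G W by (auto simp: del_vertex_def verts_induced_subgraph edges_induced_subgraph)
  have "support_vertex (del_vertex ?H z) c" if c: "c \<in> nbrs ?H z" for c
  proof -
    have cE: "{z, c} \<in> E" "c \<in> W - {z}"
      using c edge_neq[of z c] by (auto simp: nbrs_def adj_def verts_induced_subgraph edges_induced_subgraph G)
    obtain d where d: "d \<in> W - {z}" "{c, d} \<in> E" "\<forall>v\<in>W - {z}. {d, v} \<in> E \<longrightarrow> v = c"
    proof -
      have "\<exists>d\<in>W - {z}. {c, d} \<in> E \<and> (\<forall>v\<in>W - {z}. {d, v} \<in> E \<longrightarrow> v = c)"
        by (rule pendant_nbr[OF x1 nx1 ny1 Wz well2 cE(2,1)])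
      then show ?thesis using that by blast
    qed
    have "v \<in> nbrs (del_vertex ?H z) d \<longleftrightarrow> v \<in> W - {z} \<and> {d, v} \<in> E" for v
      using d(1) by (auto simp: nbrs_def adj_def vD eD)
    then have "v \<in> nbrs (del_vertex ?H z) d \<longleftrightarrow> v = c" for v
      using d(3) cE(2) edge_sym[OF d(2)] by metis
    then have "nbrs (del_vertex ?H z) d = {c}" by blast
    then have "degree (del_vertex ?H z) d = 1" by (simp add: degree_def)
    moreover have "d \<in> nbrs (del_vertex ?H z) c" using d cE by (auto simp: nbrs_def adj_def vD eD)
    ultimately show ?thesis using cE(2) by (auto simp: support_vertex_def vD)
  qed
  then have S: "strongly_detachable ?H B z" using AB(2) by (simp add: strongly_detachable_def)
  \<comment> \<open>The square \<open>p1 p2 p3 p4\<close> of the house becomes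
    \<open>y1 x1 x y\<close>, and \<open>p5\<close> becomes \<open>z\<close>.\<close>
  define h where "h k = (if k = (1::nat) then y1 else if k = 2 then x1 else if k = 3 then x
    else if k = 4 then y else z)" for k
  have "isomorphic G (identify (Inl 5) (Inr z) (disjoint_union house ?H))"
  proof (rule isomorphic_glue[where h = h])
    show "edges G = image h ` edges house \<union> edges ?H"
    proof -
      define P where "P = {{y1, x1}, {x1, x}, {x, y}, {y, y1}, {x, z}, {y, z}}"
      have "e \<in> P" if e: "e \<in> E" "\<not> e \<subseteq> W" for e
      proof -
        obtain s where s: "s \<in> e" "s \<in> {x, y, x1, y1}" using e edges_V by (auto simp: W_def)
        then obtain w where w: "e = {s, w}" using edge_at[OF e(1)] by blast
        then have E: "{s, w} \<in> E" using e(1) by simp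
        consider "s = x" | "s = y" | "s = x1" | "s = y1" using s(2) by blast
        then have "s = x \<and> w \<in> {y, z, x1} \<or> s = y \<and> w \<in> {x, z, y1} \<or>
            s = x1 \<and> w \<in> {x, y1} \<or> s = y1 \<and> w \<in> {y, x1}"
          by cases (use E nx'[of w] ny'[of w] nx1[of w] ny1[of w] in simp_all)
        then show ?thesis unfolding w P_def by (elim disjE conjE insertE) (simp_all add: insert_commute)
      qed
      moreover have "P \<subseteq> E" using x1 xy yz xz by (simp add: P_def insert_commute)
      ultimately have "E = P \<union> {e\<in>E. e \<subseteq> W}" by blast
      moreover have "image h ` edges house = P"
        by (simp add: h_def house_def P_def insert_commute)
      ultimately show ?thesis by (simp only: edges_induced_subgraph G)
    qed
  qed (use G W xyz_V distinct neqs Vs in \<open>auto simp: h_def house_def inj_on_def verts_induced_subgraph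
      edges_induced_subgraph W_def\<close>)
  then show ?thesis using G(1) AB(1) S unfolding family_F_def by blast
qed

end

theorem theorem7:
  fixes G T :: "'a graph" and x y z :: 'a
  assumes "simple_graph G"
    and "connected G"
    and "well_edge_dominated G"
    and "{H. triangle H G} = {T}"
    and "verts T = {x, y, z}"
    and "\<exists>C. component C (induced_subgraph G (verts G - {x, y, z})) \<and> nontrivial C \<and>
           (\<forall>v\<in>verts C. \<not> adj G v x \<and> \<not> adj G v y)"
  shows "G \<in> family_F \<union> family_T"
proof -
  obtain C where C: "component C (induced_subgraph G (verts G - {x, y, z}))"
    "\<forall>v\<in>verts C. \<not> adj G v x \<and> \<not> adj G v y"
    using assms(6) by blast
  obtain n where "triangle_graph (edges G) (verts G) (verts C) x y z n"
    by (rule triangle_graph_of_graph[OF assms(1-5) C])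
  then interpret triangle_graph "edges G" "verts G" "verts C" x y z n .
  show ?thesis
  proof (rule house_or_isolated)
    assume "\<And>v. v \<in> U \<Longrightarrow> {x, v} \<notin> edges G" "\<And>v. v \<in> U \<Longrightarrow> {y, v} \<notin> edges G"
    then show ?thesis using in_family_T[OF assms(1) refl refl] by blast
  next
    fix x1 y1
    assume "x1 \<in> U" "y1 \<in> U" "{x, x1} \<in> edges G" "{y, y1} \<in> edges G" "{x1, y1} \<in> edges G"
      "\<And>v. v \<in> U \<Longrightarrow> {x, v} \<in> edges G \<Longrightarrow> v = x1" "\<And>v. v \<in> U \<Longrightarrow> {y, v} \<in> edges G \<Longrightarrow> v = y1"
      "\<And>v. {x1, v} \<in> edges G \<Longrightarrow> v = x \<or> v = y1" "\<And>v. {y1, v} \<in> edges G \<Longrightarrow> v = y \<or> v = x1"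
    from in_family_F[OF assms(1) refl refl this] show ?thesis by simp
  qed
qed

end
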